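(* Let $(E \to M, [~,~], \rho, (~|~))$ be a Courant algebroid (in the sense of the definition given in the context). Then: (iii) the Leibniz rule is satisfied, i.e., $$[x,fy]= f[x,y] + (\rho(x)f)\, y$$ for all $x, y\in \Gamma E$ and all $f \in C^{\infty}(M)$; (iv) the anchor $\rho$ induces a morphism of Loday algebras from $\Gamma E$ to $\Gamma (TM)$, i.e., it satisfies $$\rho([x,y])=[\rho x,\rho y]$$ for all $x, y \in \Gamma E$, where the bracket on the right-hand side is the Lie bracket of vector fields.
   Context: A Courant algebroid is here a (smooth, real, finite rank) vector bundle $E \to M$ over a smooth manifold $M$ together with - a Loday bracket on the space of sections $\Gamma E$, i.e., an $\mathbb R$-bilinear map $[~,~] : \Gamma E \times \Gamma E \to \Gamma E$ (not assumed skew-symmetric) satisfying the Jacobi identity $[x,[y,z]]=[[x,y],z] + [y,[x,z]]$ for all $x, y, z \in \Gamma E$; - an anchor $\rho: E \to TM$, which is a morphism of vector bundles (over the identity of $M$); - a field of non-degenerate symmetric bilinear forms $(~|~)$ on the fibers of $E$; satisfying, for all $x, u, v \in \Gamma E$, (i) $\rho(x)(u|v) =(x~|~[u,v]+[v,u])$, (ii) $\rho(x)(u|v) =([x,u]~|~v)+(u~|~[x,v])$. No other axioms are imposed. *)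

theory Defs
  imports "HOL-Analysis.Analysis"
begin

section \<open>Smooth functions on open subsets of Euclidean space\<close>

text \<open>The model space is the library's \<^const>\<open>Euclidean_space\<close> \<open>n\<close>, whose points are
  the sequences vanishing from index \<open>n\<close> on. Unlike a type of class \<open>euclidean_space\<close> it may
  have dimension 0. The set \<open>V\<close> is meant to be open; values of \<open>f\<close> outside \<open>V\<close> are irrelevant.\<close>

primrec Ck_on :: "nat \<Rightarrow> nat \<Rightarrow> (nat \<Rightarrow> real) set \<Rightarrow> ((nat \<Rightarrow> real) \<Rightarrow> real) \<Rightarrow> bool" where
  "Ck_on n 0 V f \<longleftrightarrow>
     continuous_map (subtopology (Euclidean_space n) V) euclideanreal f"
| "Ck_on n (Suc k) V f \<longleftrightarrow>
     continuous_map (subtopology (Euclidean_space n) V) euclideanreal f \<and>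
     (\<exists>D. \<forall>i<n.
        (\<forall>x\<in>V. ((\<lambda>t. f (x(i := t))) has_real_derivative D i x) (at (x i))) \<and>
        Ck_on n k V (D i))"

definition Cinf_on :: "nat \<Rightarrow> (nat \<Rightarrow> real) set \<Rightarrow> ((nat \<Rightarrow> real) \<Rightarrow> real) \<Rightarrow> bool" where
  "Cinf_on n V f \<longleftrightarrow> (\<forall>k. Ck_on n k V f)"


section \<open>Smooth manifolds\<close>

text \<open>The points are \<open>topspace (mtop M)\<close>. The atlas need not be maximal; it is a set of charts
  \<open>(U, \<phi>)\<close>, where \<open>\<phi>\<close> is a total function of which only the values on \<open>U\<close> matter.\<close>

record 'm manifold =
  mtop :: "'m topology"
  mdim :: nat
  atlas :: "('m set \<times> ('m \<Rightarrow> nat \<Rightarrow> real)) set"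

abbreviation points :: "('m, 'z) manifold_scheme \<Rightarrow> 'm set" where
  "points M \<equiv> topspace (mtop M)"

definition smooth_manifold :: "'m manifold \<Rightarrow> bool" where
  "smooth_manifold M \<longleftrightarrow>
     Hausdorff_space (mtop M) \<and> second_countable (mtop M) \<and>
     (\<forall>(U, \<phi>)\<in>atlas M.
        openin (mtop M) U \<and> openin (Euclidean_space (mdim M)) (\<phi> ` U) \<and>
        homeomorphic_map (subtopology (mtop M) U)
          (subtopology (Euclidean_space (mdim M)) (\<phi> ` U)) \<phi>) \<and>
     (\<Union>(U, \<phi>)\<in>atlas M. U) = points M \<and>
     (\<forall>(U, \<phi>)\<in>atlas M. \<forall>(V, \<psi>)\<in>atlas M. \<forall>i<mdim M.
        Cinf_on (mdim M) (\<phi> ` (U \<inter> V)) (\<lambda>x. \<psi> (inv_into U \<phi> x) i))"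

text \<open>Smooth functions on an open subset \<open>W\<close> of \<open>M\<close>; values outside \<open>W\<close> are irrelevant.\<close>

definition smooth_fun_on :: "'m manifold \<Rightarrow> 'm set \<Rightarrow> ('m \<Rightarrow> real) \<Rightarrow> bool" where
  "smooth_fun_on M W f \<longleftrightarrow>
     (\<forall>(U, \<phi>)\<in>atlas M. Cinf_on (mdim M) (\<phi> ` (U \<inter> W)) (\<lambda>x. f (inv_into U \<phi> x)))"

definition Cinf :: "'m manifold \<Rightarrow> ('m \<Rightarrow> real) set" where
  "Cinf M = {f. smooth_fun_on M (points M) f}"

definition smooth_near :: "'m manifold \<Rightarrow> 'm \<Rightarrow> ('m \<Rightarrow> real) \<Rightarrow> bool" where
  "smooth_near M p f \<longleftrightarrow> (\<exists>W. openin (mtop M) W \<and> p \<in> W \<and> smooth_fun_on M W f)"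


section \<open>Smooth vector bundles\<close>

definition real_vector_space_on ::
    "'e set \<Rightarrow> ('e \<Rightarrow> 'e \<Rightarrow> 'e) \<Rightarrow> 'e \<Rightarrow> (real \<Rightarrow> 'e \<Rightarrow> 'e) \<Rightarrow> bool" where
  "real_vector_space_on S add z scl \<longleftrightarrow>
     z \<in> S \<and> (\<forall>a\<in>S. \<forall>b\<in>S. add a b \<in> S) \<and> (\<forall>c. \<forall>a\<in>S. scl c a \<in> S) \<and>
     (\<forall>a\<in>S. \<forall>b\<in>S. \<forall>c\<in>S. add (add a b) c = add a (add b c)) \<and>
     (\<forall>a\<in>S. \<forall>b\<in>S. add a b = add b a) \<and>
     (\<forall>a\<in>S. add z a = a) \<and> (\<forall>a\<in>S. \<exists>b\<in>S. add a b = z) \<and>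
     (\<forall>c. \<forall>a\<in>S. \<forall>b\<in>S. scl c (add a b) = add (scl c a) (scl c b)) \<and>
     (\<forall>c d. \<forall>a\<in>S. scl (c + d) a = add (scl c a) (scl d a)) \<and>
     (\<forall>c d. \<forall>a\<in>S. scl c (scl d a) = scl (c * d) a) \<and>
     (\<forall>a\<in>S. scl 1 a = a)"

text \<open>A bundle is given by its total space, projection, fibrewise operations and a bundle atlas
  of local trivializations \<open>(U, \<Phi>)\<close>. Here \<open>\<Phi>\<close> is the \<open>\<real>\<^sup>r\<close>-component of the trivialization
  \<open>a \<mapsto> (bproj E a, \<Phi> a)\<close> over \<open>U\<close>. As usual, the topology and smooth structure of the total
  space are those determined by the bundle atlas, so they are not separate data.\<close>

record ('m, 'e) vbundle =
  bundle_total :: "'e set"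
  bproj :: "'e \<Rightarrow> 'm"
  fadd :: "'e \<Rightarrow> 'e \<Rightarrow> 'e"
  fzero :: "'m \<Rightarrow> 'e"
  fscale :: "real \<Rightarrow> 'e \<Rightarrow> 'e"
  bundle_rank :: nat
  trivs :: "('m set \<times> ('e \<Rightarrow> nat \<Rightarrow> real)) set"

definition fibre :: "('m, 'e) vbundle \<Rightarrow> 'm \<Rightarrow> 'e set" where
  "fibre E p = {a \<in> bundle_total E. bproj E a = p}"

text \<open>The \<open>j\<close>-th element, at \<open>p\<close>, of the local frame of a trivialization.\<close>

definition frame :: "('m, 'e) vbundle \<Rightarrow> ('e \<Rightarrow> nat \<Rightarrow> real) \<Rightarrow> nat \<Rightarrow> 'm \<Rightarrow> 'e" where
  "frame E \<Phi> j p = inv_into (fibre E p) \<Phi> (\<lambda>i. if i = j then 1 else 0)"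

definition smooth_vector_bundle :: "'m manifold \<Rightarrow> ('m, 'e) vbundle \<Rightarrow> bool" where
  "smooth_vector_bundle M E \<longleftrightarrow>
     bproj E ` bundle_total E \<subseteq> points M \<and>
     (\<forall>p\<in>points M. real_vector_space_on (fibre E p) (fadd E) (fzero E p) (fscale E)) \<and>
     (\<forall>(U, \<Phi>)\<in>trivs E. openin (mtop M) U \<and>
        (\<forall>p\<in>U. bij_betw \<Phi> (fibre E p) (topspace (Euclidean_space (bundle_rank E))) \<and>
          (\<forall>a\<in>fibre E p. \<forall>b\<in>fibre E p. \<forall>i. \<Phi> (fadd E a b) i = \<Phi> a i + \<Phi> b i) \<and>
          (\<forall>c. \<forall>a\<in>fibre E p. \<forall>i. \<Phi> (fscale E c a) i = c * \<Phi> a i))) \<and>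
     (\<Union>(U, \<Phi>)\<in>trivs E. U) = points M \<and>
     (\<forall>(U, \<Phi>)\<in>trivs E. \<forall>(V, \<Psi>)\<in>trivs E. \<forall>i<bundle_rank E. \<forall>j<bundle_rank E.
        smooth_fun_on M (U \<inter> V) (\<lambda>p. \<Psi> (frame E \<Phi> j p) i))"

text \<open>Smooth global sections, as functions that are \<^const>\<open>undefined\<close> outside \<open>points M\<close>,
  so that equality of sections is equality of functions.\<close>

definition sections :: "'m manifold \<Rightarrow> ('m, 'e) vbundle \<Rightarrow> ('m \<Rightarrow> 'e) set" where
  "sections M E = {s \<in> extensional (points M).
     (\<forall>p\<in>points M. s p \<in> fibre E p) \<and>
     (\<forall>(U, \<Phi>)\<in>trivs E. \<forall>i<bundle_rank E. smooth_fun_on M U (\<lambda>p. \<Phi> (s p) i))}"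

definition sadd ::
    "'m manifold \<Rightarrow> ('m, 'e) vbundle \<Rightarrow> ('m \<Rightarrow> 'e) \<Rightarrow> ('m \<Rightarrow> 'e) \<Rightarrow> 'm \<Rightarrow> 'e" where
  "sadd M E x y = (\<lambda>p\<in>points M. fadd E (x p) (y p))"

definition fmult ::
    "'m manifold \<Rightarrow> ('m, 'e) vbundle \<Rightarrow> ('m \<Rightarrow> real) \<Rightarrow> ('m \<Rightarrow> 'e) \<Rightarrow> 'm \<Rightarrow> 'e" where
  "fmult M E f x = (\<lambda>p\<in>points M. fscale E (f p) (x p))"

text \<open>Morphisms over the identity of \<open>M\<close>: fibrewise linear, with smooth matrix entries in local
  trivializations.\<close>

definition vbundle_morphism ::
    "'m manifold \<Rightarrow> ('m, 'e) vbundle \<Rightarrow> ('m, 'f) vbundle \<Rightarrow> ('e \<Rightarrow> 'f) \<Rightarrow> bool" where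
  "vbundle_morphism M E F h \<longleftrightarrow>
     (\<forall>p\<in>points M.
        (\<forall>a\<in>fibre E p. h a \<in> fibre F p) \<and>
        (\<forall>a\<in>fibre E p. \<forall>b\<in>fibre E p. h (fadd E a b) = fadd F (h a) (h b)) \<and>
        (\<forall>c. \<forall>a\<in>fibre E p. h (fscale E c a) = fscale F c (h a))) \<and>
     (\<forall>(U, \<Phi>)\<in>trivs E. \<forall>(V, \<Psi>)\<in>trivs F. \<forall>i<bundle_rank F. \<forall>j<bundle_rank E.
        smooth_fun_on M (U \<inter> V) (\<lambda>p. \<Psi> (h (frame E \<Phi> j p)) i))"


section \<open>The tangent bundle\<close>

text \<open>Tangent vectors at \<open>p\<close> are derivations of the algebra of germs at \<open>p\<close> of smooth functions.
  A derivation is represented by a function on all of \<open>'m \<Rightarrow> real\<close> that depends only on the germ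
  of its argument and is set to 0 on functions which are not smooth near \<open>p\<close>.\<close>

definition derivation_at :: "'m manifold \<Rightarrow> 'm \<Rightarrow> (('m \<Rightarrow> real) \<Rightarrow> real) \<Rightarrow> bool" where
  "derivation_at M p D \<longleftrightarrow>
     (\<forall>f. \<not> smooth_near M p f \<longrightarrow> D f = 0) \<and>
     (\<forall>f g W. smooth_near M p f \<and> smooth_near M p g \<and>
        openin (mtop M) W \<and> p \<in> W \<and> (\<forall>q\<in>W. f q = g q) \<longrightarrow> D f = D g) \<and>
     (\<forall>f g. smooth_near M p f \<and> smooth_near M p g \<longrightarrow>
        D (\<lambda>q. f q + g q) = D f + D g \<and>
        D (\<lambda>q. f q * g q) = D f * g p + f p * D g) \<and>
     (\<forall>c f. smooth_near M p f \<longrightarrow> D (\<lambda>q. c * f q) = c * D f)"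

text \<open>A chart \<open>(U, \<phi>)\<close> induces the trivialization \<open>v \<mapsto> (v \<phi>\<^sub>i)\<^sub>i\<close> over \<open>U\<close>.\<close>

definition tangent_bundle :: "'m manifold \<Rightarrow> ('m, 'm \<times> (('m \<Rightarrow> real) \<Rightarrow> real)) vbundle" where
  "tangent_bundle M = \<lparr>
     bundle_total = {(p, D). p \<in> points M \<and> derivation_at M p D},
     bproj = fst,
     fadd = (\<lambda>v w. (fst v, \<lambda>f. snd v f + snd w f)),
     fzero = (\<lambda>p. (p, \<lambda>f. 0)),
     fscale = (\<lambda>c v. (fst v, \<lambda>f. c * snd v f)),
     bundle_rank = mdim M,
     trivs = (\<lambda>(U, \<phi>). (U, \<lambda>v i. if i < mdim M then snd v (\<lambda>q. \<phi> q i) else 0)) ` atlas M\<rparr>"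

definition vf_apply ::
    "('m \<Rightarrow> 'm \<times> (('m \<Rightarrow> real) \<Rightarrow> real)) \<Rightarrow> ('m \<Rightarrow> real) \<Rightarrow> 'm \<Rightarrow> real" where
  "vf_apply X f = (\<lambda>p. snd (X p) f)"

definition lie_bracket ::
    "'m manifold \<Rightarrow> ('m \<Rightarrow> 'm \<times> (('m \<Rightarrow> real) \<Rightarrow> real)) \<Rightarrow>
     ('m \<Rightarrow> 'm \<times> (('m \<Rightarrow> real) \<Rightarrow> real)) \<Rightarrow> 'm \<Rightarrow> 'm \<times> (('m \<Rightarrow> real) \<Rightarrow> real)" where
  "lie_bracket M X Y = (\<lambda>p\<in>points M. (p, \<lambda>f.
     if smooth_near M p f
     then vf_apply X (vf_apply Y f) p - vf_apply Y (vf_apply X f) p else 0))"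


section \<open>Courant algebroids\<close>

definition loday_bracket ::
    "'m manifold \<Rightarrow> ('m, 'e) vbundle \<Rightarrow> (('m \<Rightarrow> 'e) \<Rightarrow> ('m \<Rightarrow> 'e) \<Rightarrow> 'm \<Rightarrow> 'e) \<Rightarrow> bool" where
  "loday_bracket M E br \<longleftrightarrow>
     (\<forall>x\<in>sections M E. \<forall>y\<in>sections M E. br x y \<in> sections M E) \<and>
     (\<forall>x\<in>sections M E. \<forall>y\<in>sections M E. \<forall>z\<in>sections M E.
        br (sadd M E x y) z = sadd M E (br x z) (br y z) \<and>
        br x (sadd M E y z) = sadd M E (br x y) (br x z)) \<and>
     (\<forall>c::real. \<forall>x\<in>sections M E. \<forall>y\<in>sections M E.
        br (fmult M E (\<lambda>_. c) x) y = fmult M E (\<lambda>_. c) (br x y) \<and>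
        br x (fmult M E (\<lambda>_. c) y) = fmult M E (\<lambda>_. c) (br x y)) \<and>
     (\<forall>x\<in>sections M E. \<forall>y\<in>sections M E. \<forall>z\<in>sections M E.
        br x (br y z) = sadd M E (br (br x y) z) (br y (br x z)))"

text \<open>A (smooth) field of non-degenerate symmetric bilinear forms on the fibres.\<close>

definition fibre_metric :: "'m manifold \<Rightarrow> ('m, 'e) vbundle \<Rightarrow> ('e \<Rightarrow> 'e \<Rightarrow> real) \<Rightarrow> bool" where
  "fibre_metric M E B \<longleftrightarrow>
     (\<forall>p\<in>points M.
        (\<forall>a\<in>fibre E p. \<forall>b\<in>fibre E p. B a b = B b a) \<and>
        (\<forall>a\<in>fibre E p. \<forall>b\<in>fibre E p. \<forall>c\<in>fibre E p.
           B (fadd E a b) c = B a c + B b c) \<and>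
        (\<forall>t. \<forall>a\<in>fibre E p. \<forall>b\<in>fibre E p. B (fscale E t a) b = t * B a b) \<and>
        (\<forall>a\<in>fibre E p. (\<forall>b\<in>fibre E p. B a b = 0) \<longrightarrow> a = fzero E p)) \<and>
     (\<forall>(U, \<Phi>)\<in>trivs E. \<forall>i<bundle_rank E. \<forall>j<bundle_rank E.
        smooth_fun_on M U (\<lambda>p. B (frame E \<Phi> i p) (frame E \<Phi> j p)))"

text \<open>The map induced on sections by a bundle morphism.\<close>

definition on_sections :: "'m manifold \<Rightarrow> ('e \<Rightarrow> 'f) \<Rightarrow> ('m \<Rightarrow> 'e) \<Rightarrow> 'm \<Rightarrow> 'f" where
  "on_sections M h x = (\<lambda>p\<in>points M. h (x p))"

definition courant_algebroid ::
    "'m manifold \<Rightarrow> ('m, 'e) vbundle \<Rightarrow> (('m \<Rightarrow> 'e) \<Rightarrow> ('m \<Rightarrow> 'e) \<Rightarrow> 'm \<Rightarrow> 'e) \<Rightarrow>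
     ('e \<Rightarrow> 'm \<times> (('m \<Rightarrow> real) \<Rightarrow> real)) \<Rightarrow> ('e \<Rightarrow> 'e \<Rightarrow> real) \<Rightarrow> bool" where
  "courant_algebroid M E br \<rho> B \<longleftrightarrow>
     smooth_manifold M \<and> smooth_vector_bundle M E \<and>
     loday_bracket M E br \<and>
     vbundle_morphism M E (tangent_bundle M) \<rho> \<and>
     fibre_metric M E B \<and>
     (\<forall>x\<in>sections M E. \<forall>u\<in>sections M E. \<forall>v\<in>sections M E. \<forall>p\<in>points M.
        vf_apply (on_sections M \<rho> x) (\<lambda>q. B (u q) (v q)) p
          = B (x p) (sadd M E (br u v) (br v u) p)) \<and>
     (\<forall>x\<in>sections M E. \<forall>u\<in>sections M E. \<forall>v\<in>sections M E. \<forall>p\<in>points M.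
        vf_apply (on_sections M \<rho> x) (\<lambda>q. B (u q) (v q)) p
          = B (br x u p) (v p) + B (u p) (br x v p))"

text \<open>\<open>H\<close> is an \<open>\<real>\<close>-linear map from the sections of \<open>E\<close> to those of \<open>F\<close> which respects the
  brackets.\<close>

definition loday_morphism ::
    "'m manifold \<Rightarrow> ('m, 'e) vbundle \<Rightarrow> (('m \<Rightarrow> 'e) \<Rightarrow> ('m \<Rightarrow> 'e) \<Rightarrow> 'm \<Rightarrow> 'e) \<Rightarrow>
     ('m, 'f) vbundle \<Rightarrow> (('m \<Rightarrow> 'f) \<Rightarrow> ('m \<Rightarrow> 'f) \<Rightarrow> 'm \<Rightarrow> 'f) \<Rightarrow>
     (('m \<Rightarrow> 'e) \<Rightarrow> 'm \<Rightarrow> 'f) \<Rightarrow> bool" where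
  "loday_morphism M E brE F brF H \<longleftrightarrow>
     (\<forall>x\<in>sections M E. H x \<in> sections M F) \<and>
     (\<forall>x\<in>sections M E. \<forall>y\<in>sections M E. H (sadd M E x y) = sadd M F (H x) (H y)) \<and>
     (\<forall>c::real. \<forall>x\<in>sections M E. H (fmult M E (\<lambda>_. c) x) = fmult M F (\<lambda>_. c) (H x)) \<and>
     (\<forall>x\<in>sections M E. \<forall>y\<in>sections M E. H (brE x y) = brF (H x) (H y))"

end

theory Submission
  imports Defs "HOL-Computational_Algebra.Polynomial"
begin

text \<open>The central point is that non-degeneracy and invariance of the form force the Leibniz
rule: computing \<open>\<rho>(x)(u|fy)\<close> once by invariance and once by the product rule for the derivation
\<open>\<rho>(x)\<close> gives \<open>(u|[x,fy]) = (u|f[x,y] + (\<rho>(x)f)y)\<close> for all sections \<open>u\<close>. This is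
\<open>leibniz_at\<close>. The compatibility of the anchor with the brackets is then the comparison of the
Jacobi identity for \<open>x, y, fv\<close> with the one for \<open>x, y, v\<close>: everything except
\<open>(\<rho>([x,y])f - [\<rho>x,\<rho>y]f) v\<close> cancels. This is \<open>der_bracket\<close>; it iterates the Leibniz rule
and therefore relies on \<open>\<rho>(y)f\<close> being smooth, which also comes out of the Leibniz rule
(\<open>der_smooth\<close>).

The passage between global sections and functions, for which the axioms are stated, and vectors
and germs at a point rests on bump functions. A vector in a fibre must be the value of a section
(\<open>section_through\<close>) in order that the form can be cancelled, and a germ of a smooth function must
extend to a function on \<open>M\<close> (\<open>smooth_germ_extends\<close>), since a tangent vector is a derivation of
germs. The calculus this takes is modest: sums, products, locality, and composition with a
function of one real variable, because the bump function (\<open>bump_function\<close>) can be chosen as a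
function of a polynomial in chart coordinates.\<close>

section \<open>Calculus of smooth functions on open subsets of Euclidean space\<close>

lemma Ck_on_imp_continuous_map:
  "Ck_on n k V f \<Longrightarrow> continuous_map (subtopology (Euclidean_space n) V) euclideanreal f"
  by (cases k) auto

lemma Ck_on_SucD: "Ck_on n (Suc k) V f \<Longrightarrow> Ck_on n k V f"
proof (induction k arbitrary: f)
  case (Suc k)
  then show ?case by (metis Ck_on.simps(2))
qed simp

lemma Ck_on_subset: "Ck_on n k V f \<Longrightarrow> W \<subseteq> V \<Longrightarrow> Ck_on n k W f"
proof (induction k arbitrary: f)
  case 0
  then show ?case
    by (metis Ck_on.simps(1) continuous_map_from_subtopology_mono)
next
  case (Suc k)
  then obtain D where "\<forall>i<n. (\<forall>x\<in>V. ((\<lambda>t. f (x(i := t))) has_real_derivative D i x) (at (x i))) \<and>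
        Ck_on n k V (D i)" by auto
  then have "\<forall>i<n. (\<forall>x\<in>W. ((\<lambda>t. f (x(i := t))) has_real_derivative D i x) (at (x i))) \<and>
        Ck_on n k W (D i)" using Suc by blast
  moreover have "continuous_map (subtopology (Euclidean_space n) W) euclideanreal f"
    using Suc.prems by (metis Ck_on.simps(2) continuous_map_from_subtopology_mono)
  ultimately show ?case by auto
qed

text \<open>The partial derivatives in \<^const>\<open>Ck_on\<close> are taken along coordinate lines of the whole model
space. Openness of \<open>V\<close> keeps such a line inside \<open>V\<close> near \<open>x\<close>, so that the derivatives
of a function on \<open>V\<close> depend only on its values on \<open>V\<close>.\<close>

lemma eventually_coordinate_line_in:
  assumes V: "openin (Euclidean_space n) V" and x: "x \<in> V" and i: "i < n"
  shows "\<forall>\<^sub>F t in nhds (x i). x(i := t) \<in> V"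
proof -
  have xH: "\<forall>j\<ge>n. x j = 0"
    using openin_subset[OF V] x by (auto simp: topspace_Euclidean_space)
  have "continuous_map euclideanreal (Euclidean_space n) (\<lambda>t. x(i := t))"
    unfolding Euclidean_space_def continuous_map_in_subtopology continuous_map_componentwise_UNIV
    using xH i by (auto simp: fun_upd_def)
  then have "open {t. x(i := t) \<in> V}"
    using openin_continuous_map_preimage[OF _ V] by fastforce
  moreover have "x i \<in> {t. x(i := t) \<in> V}" using x by simp
  ultimately show ?thesis
    using eventually_nhds by blast
qed

lemma has_real_derivative_cong_nhds:
  fixes f g :: "real \<Rightarrow> real"
  assumes "\<forall>\<^sub>F t in nhds x. f t = g t" and "(f has_real_derivative D) (at x)"
  shows "(g has_real_derivative D) (at x)"
  using DERIV_cong_ev[OF refl assms(1) refl] assms(2) by blast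

lemma Ck_on_cong:
  assumes V: "openin (Euclidean_space n) V" and eq: "\<And>x. x \<in> V \<Longrightarrow> f x = g x" and f: "Ck_on n k V f"
  shows "Ck_on n k V g"
proof -
  have c: "continuous_map (subtopology (Euclidean_space n) V) euclideanreal g"
    using Ck_on_imp_continuous_map[OF f] by (rule continuous_map_eq) (use eq in auto)
  show ?thesis
  proof (cases k)
    case 0 with c show ?thesis by simp
  next
    case (Suc l)
    then obtain D where D: "\<forall>i<n. (\<forall>x\<in>V. ((\<lambda>t. f (x(i := t))) has_real_derivative D i x) (at (x i))) \<and>
        Ck_on n l V (D i)" using f by auto
    have "((\<lambda>t. g (x(i := t))) has_real_derivative D i x) (at (x i))" if "i < n" "x \<in> V" for i x
    proof -
      have "\<forall>\<^sub>F t in nhds (x i). f (x(i := t)) = g (x(i := t))"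
        using eventually_coordinate_line_in[OF V that(2,1)] by eventually_elim (rule eq)
      then show ?thesis by (rule has_real_derivative_cong_nhds) (use D that in blast)
    qed
    then show ?thesis using c D Suc by auto
  qed
qed

lemma continuous_map_local:
  assumes "\<And>x. x \<in> V \<Longrightarrow> \<exists>N. openin T N \<and> x \<in> N \<and> N \<subseteq> V \<and> continuous_map (subtopology T N) U f"
  shows "continuous_map (subtopology T V) U f"
proof -
  obtain N where N: "\<And>x. x \<in> V \<Longrightarrow> openin T (N x) \<and> x \<in> N x \<and> N x \<subseteq> V \<and> continuous_map (subtopology T (N x)) U f"
    using assms by metis
  obtain g where g: "continuous_map (subtopology T V) U g"
    and eq: "\<And>i x. i \<in> V \<Longrightarrow> x \<in> topspace (subtopology T V) \<inter> N i \<Longrightarrow> g x = f x"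
  proof (rule pasting_lemma_exists[where I = V and T = N and f = "\<lambda>_. f"])
    show "topspace (subtopology T V) \<subseteq> \<Union> (N ` V)" using N by auto
    show "openin (subtopology T V) (N x)" if "x \<in> V" for x
      using N[OF that] openin_subtopology by (metis inf.absorb1)
    show "continuous_map (subtopology (subtopology T V) (N x)) U f" if "x \<in> V" for x
      using N[OF that] by (simp add: subtopology_subtopology inf.absorb2)
  qed (rule refl, erule that, blast)
  show ?thesis
    by (rule continuous_map_eq[OF g]) (use eq N in auto)
qed

text \<open>The partial derivatives are unique, so those found on the small open sets agree on overlaps and
are restrictions of one function \<open>D i\<close>, to which the induction hypothesis applies.\<close>

lemma Ck_on_local:
  assumes "\<And>x. x \<in> V \<Longrightarrow> \<exists>N. openin (Euclidean_space n) N \<and> x \<in> N \<and> N \<subseteq> V \<and> Ck_on n k N f"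
  shows "Ck_on n k V f"
  using assms
proof (induction k arbitrary: f)
  case 0
  show ?case unfolding Ck_on.simps by (rule continuous_map_local) (use 0 in simp)
next
  case (Suc k)
  define D where "D = (\<lambda>i x. deriv (\<lambda>t. f (x(i := t))) (x i))"
  have *: "\<exists>N. openin (Euclidean_space n) N \<and> x \<in> N \<and> N \<subseteq> V \<and>
      (\<forall>i<n. (\<forall>y\<in>N. ((\<lambda>t. f (y(i := t))) has_real_derivative D i y) (at (y i))) \<and> Ck_on n k N (D i))"
    if x: "x \<in> V" for x
  proof -
    obtain N where N: "openin (Euclidean_space n) N" "x \<in> N" "N \<subseteq> V" "Ck_on n (Suc k) N f"
      using Suc.prems[OF x] by blast
    then obtain D' where D': "\<And>i y. i < n \<Longrightarrow> y \<in> N \<Longrightarrow> ((\<lambda>t. f (y(i := t))) has_real_derivative D' i y) (at (y i))"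
      "\<And>i. i < n \<Longrightarrow> Ck_on n k N (D' i)" by auto
    have eq: "D' i y = D i y" if "i < n" "y \<in> N" for i y
      using DERIV_imp_deriv[OF D'(1)[OF that]] by (simp add: D_def)
    have "Ck_on n k N (D i)" if "i < n" for i
      by (rule Ck_on_cong[OF N(1) _ D'(2)[OF that]]) (use eq that in auto)
    moreover have "((\<lambda>t. f (y(i := t))) has_real_derivative D i y) (at (y i))" if "i < n" "y \<in> N" for i y
      using D'(1)[OF that] eq[OF that] by simp
    ultimately show ?thesis using N(1-3) by (intro exI[of _ N]) simp
  qed
  have "Ck_on n k V (D i)" if i: "i < n" for i
  proof (rule Suc.IH)
    fix x assume "x \<in> V"
    from *[OF this] i show "\<exists>N. openin (Euclidean_space n) N \<and> x \<in> N \<and> N \<subseteq> V \<and> Ck_on n k N (D i)"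
      by (elim exE conjE) (intro exI conjI, assumption+, simp)
  qed
  moreover have "((\<lambda>t. f (x(i := t))) has_real_derivative D i x) (at (x i))" if "i < n" "x \<in> V" for i x
    using *[OF that(2)] that(1) by (elim exE conjE) simp
  moreover have "continuous_map (subtopology (Euclidean_space n) V) euclideanreal f"
  proof (rule continuous_map_local)
    fix x assume "x \<in> V"
    from Suc.prems[OF this] Ck_on_imp_continuous_map
    show "\<exists>N. openin (Euclidean_space n) N \<and> x \<in> N \<and> N \<subseteq> V \<and>
        continuous_map (subtopology (Euclidean_space n) N) euclideanreal f" by metis
  qed
  ultimately show ?case unfolding Ck_on.simps by (intro conjI exI[of _ D]) blast+
qed

lemma Ck_on_const: "Ck_on n k V (\<lambda>_. c)"
proof (induction k arbitrary: c)
  case (Suc k)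
  then show ?case by (auto intro!: exI[of _ "\<lambda>_ _. 0"])
qed simp

lemma Ck_on_add: "Ck_on n k V f \<Longrightarrow> Ck_on n k V g \<Longrightarrow> Ck_on n k V (\<lambda>x. f x + g x)"
proof (induction k arbitrary: f g)
  case 0
  then show ?case by (auto intro: continuous_map_add)
next
  case (Suc k)
  from Suc.prems obtain D D' where
    D: "\<forall>i<n. (\<forall>x\<in>V. ((\<lambda>t. f (x(i := t))) has_real_derivative D i x) (at (x i))) \<and> Ck_on n k V (D i)" and
    D': "\<forall>i<n. (\<forall>x\<in>V. ((\<lambda>t. g (x(i := t))) has_real_derivative D' i x) (at (x i))) \<and> Ck_on n k V (D' i)"
    by auto
  have "\<forall>i<n. (\<forall>x\<in>V. ((\<lambda>t. f (x(i := t)) + g (x(i := t))) has_real_derivative D i x + D' i x) (at (x i)))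
      \<and> Ck_on n k V (\<lambda>x. D i x + D' i x)"
    using D D' Suc.IH by (auto intro: DERIV_add)
  then show ?case using Suc.prems by (auto intro!: continuous_map_add exI[of _ "\<lambda>i x. D i x + D' i x"])
qed

lemma Ck_on_mult: "Ck_on n k V f \<Longrightarrow> Ck_on n k V g \<Longrightarrow> Ck_on n k V (\<lambda>x. f x * g x)"
proof (induction k arbitrary: f g)
  case 0
  then show ?case by (auto intro: continuous_map_real_mult)
next
  case (Suc k)
  from Suc.prems obtain D D' where
    D: "\<forall>i<n. (\<forall>x\<in>V. ((\<lambda>t. f (x(i := t))) has_real_derivative D i x) (at (x i))) \<and> Ck_on n k V (D i)" and
    D': "\<forall>i<n. (\<forall>x\<in>V. ((\<lambda>t. g (x(i := t))) has_real_derivative D' i x) (at (x i))) \<and> Ck_on n k V (D' i)"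
    by auto
  let ?E = "\<lambda>i x. D i x * g x + f x * D' i x"
  have "((\<lambda>t. f (x(i := t)) * g (x(i := t))) has_real_derivative ?E i x) (at (x i))"
    if "i < n" "x \<in> V" for i x
    using DERIV_mult[of "\<lambda>t. f (x(i := t))" "D i x" "x i" UNIV "\<lambda>t. g (x(i := t))" "D' i x"] D D' that
    by (simp add: algebra_simps)
  moreover have "Ck_on n k V (?E i)" if "i < n" for i
    using D D' that Suc.prems[THEN Ck_on_SucD] by (intro Ck_on_add Suc.IH) blast+
  ultimately show ?case using Suc.prems by (auto intro!: continuous_map_real_mult exI[of _ ?E])
qed

text \<open>The chain rule with a function of one real variable outside, whose successive derivatives are
\<open>h\<close>. The order \<open>m\<close> has to vary because the derivative of \<open>h m \<circ> f\<close> contains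
\<open>h (Suc m) \<circ> f\<close>.\<close>

lemma Ck_on_compose_real:
  assumes h: "\<And>m t. (h m has_real_derivative h (Suc m) t) (at t)" and f: "Ck_on n k V f"
  shows "Ck_on n k V (\<lambda>x. h m (f x))"
proof -
  have cont: "continuous_map (subtopology (Euclidean_space n) V) euclideanreal (\<lambda>x. h m (f x))"
    if "Ck_on n k V f" for k m
  proof -
    have "continuous_on UNIV (h m)"
      using h by (meson DERIV_continuous_on has_field_derivative_at_within)
    then have "continuous_map euclideanreal euclideanreal (h m)" by simp
    from continuous_map_compose[OF Ck_on_imp_continuous_map[OF that] this] show ?thesis
      by (simp add: o_def)
  qed
  show ?thesis
    using f
  proof (induction k arbitrary: m)
    case 0
    then show ?case using cont[of 0] by simp
  next
    case (Suc k)
    from Suc.prems obtain D where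
      D: "\<forall>i<n. (\<forall>x\<in>V. ((\<lambda>t. f (x(i := t))) has_real_derivative D i x) (at (x i))) \<and> Ck_on n k V (D i)"
      by auto
    let ?E = "\<lambda>i x. h (Suc m) (f x) * D i x"
    have "((\<lambda>t. h m (f (x(i := t)))) has_real_derivative ?E i x) (at (x i))"
      if "i < n" "x \<in> V" for i x
      using DERIV_chain2[of "h m" "h (Suc m) (f x)" "\<lambda>t. f (x(i := t))" "x i" "D i x" UNIV] h D that
      by simp
    moreover have "Ck_on n k V (?E i)" if "i < n" for i
      using D that Suc.IH[OF Suc.prems[THEN Ck_on_SucD]] by (intro Ck_on_mult) blast+
    ultimately show ?case using cont[OF Suc.prems] by (auto intro!: exI[of _ ?E])
  qed
qed

section \<open>A smooth plateau function on the real line\<close>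

definition smooth_real :: "(real \<Rightarrow> real) \<Rightarrow> bool" where
  "smooth_real g \<longleftrightarrow> (\<exists>h. h 0 = g \<and> (\<forall>m t. (h m has_real_derivative h (Suc m) t) (at t)))"

text \<open>The functions \<open>p(1/t) exp(-1/t)\<close> with \<open>p\<close> a polynomial are closed under differentiation;
the one with \<open>p = 1\<close> is the classical smooth function that is flat at 0.\<close>

definition flat_exp :: "real poly \<Rightarrow> real \<Rightarrow> real" where
  "flat_exp p t = (if t > 0 then poly p (1 / t) * exp (- (1 / t)) else 0)"

lemma poly_mult_exp_minus_tendsto_0:
  "((\<lambda>s. poly p s * exp (- s)) \<longlongrightarrow> (0::real)) at_top"
proof -
  have "((\<lambda>s. \<Sum>i\<le>degree p. coeff p i * (s ^ i / exp s)) \<longlongrightarrow> (\<Sum>i\<le>degree p. coeff p i * 0)) at_top"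
    by (intro tendsto_sum tendsto_mult tendsto_const tendsto_power_div_exp_0)
  then show ?thesis
    by (simp add: poly_altdef exp_minus sum_divide_distrib divide_inverse sum_distrib_right mult.assoc)
qed

text \<open>For \<open>t > 0\<close> the derivative of \<open>1/t\<close> is \<open>- (1/t)\<^sup>2\<close>, so that \<open>p\<close> is replaced by
\<open>X\<^sup>2 (p - p')\<close>. At \<open>t = 0\<close> the exponential beats every polynomial.\<close>

lemma flat_exp_has_derivative:
  "(flat_exp p has_real_derivative flat_exp (monom 1 2 * (p - pderiv p)) t) (at t)"
proof -
  consider "t < 0" | "t = 0" | "t > 0" by linarith
  then show ?thesis
  proof cases
    case 1
    have "\<forall>\<^sub>F s in nhds t. 0 = flat_exp p s"
      using eventually_nhds_in_open[of "{..<0}" t] 1 by (auto elim!: eventually_mono simp: flat_exp_def)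
    then have "(flat_exp p has_real_derivative 0) (at t)"
      by (rule has_real_derivative_cong_nhds) simp
    then show ?thesis using 1 by (simp add: flat_exp_def)
  next
    case 2
    \<comment> \<open>The difference quotient at 0 multiplies \<open>p(1/h)\<close> by a further factor \<open>1/h\<close>.\<close>
    have "((\<lambda>h. poly (pCons 0 p) (1 / h) * exp (- (1 / h))) \<longlongrightarrow> (0::real)) (at_right 0)"
      using filterlim_compose[OF poly_mult_exp_minus_tendsto_0 filterlim_inverse_at_top_right, of "pCons 0 p"]
      by (simp add: divide_inverse)
    moreover have "\<forall>\<^sub>F h in at_right (0::real). poly (pCons 0 p) (1 / h) * exp (- (1 / h)) = flat_exp p h / h"
      by (auto simp: eventually_at_right_less flat_exp_def intro!: eventually_mono[OF eventually_at_right_less])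
    ultimately have r: "((\<lambda>h. flat_exp p h / h) \<longlongrightarrow> 0) (at_right 0)"
      by (rule Lim_transform_eventually)
    have "\<forall>\<^sub>F h in at_left (0::real). 0 = flat_exp p h / h"
      by (rule eventually_at_leftI[of "-1"]) (auto simp: flat_exp_def)
    then have "((\<lambda>h. flat_exp p h / h) \<longlongrightarrow> 0) (at_left 0)"
      by (rule Lim_transform_eventually[OF tendsto_const])
    with r have "((\<lambda>h. flat_exp p h / h) \<longlongrightarrow> 0) (at 0)"
      by (rule filterlim_split_at_real[rotated])
    then show ?thesis using 2 by (simp add: DERIV_def flat_exp_def)
  next
    case 3
    have "\<forall>\<^sub>F s in nhds t. poly p (1 / s) * exp (- (1 / s)) = flat_exp p s"
      using eventually_nhds_in_open[of "{0<..}" t] 3 by (auto elim!: eventually_mono simp: flat_exp_def)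
    moreover have "((\<lambda>s. poly p (1 / s) * exp (- (1 / s))) has_real_derivative
        flat_exp (monom 1 2 * (p - pderiv p)) t) (at t)"
    proof -
      have i: "((\<lambda>s. 1 / s) has_real_derivative - (1 / t\<^sup>2)) (at t)"
        using 3 DERIV_inverse[of t UNIV] by (simp add: divide_inverse power2_eq_square)
      have "((\<lambda>s. poly p (1 / s)) has_real_derivative poly (pderiv p) (1 / t) * (- (1 / t\<^sup>2))) (at t)"
        by (rule DERIV_chain2[OF poly_DERIV i])
      moreover have "((\<lambda>s. exp (- (1 / s))) has_real_derivative exp (- (1 / t)) * (- (- (1 / t\<^sup>2)))) (at t)"
        by (rule DERIV_chain2[OF DERIV_exp DERIV_minus[OF i]])
      ultimately have "((\<lambda>s. poly p (1 / s) * exp (- (1 / s))) has_real_derivative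
          poly (pderiv p) (1 / t) * (- (1 / t\<^sup>2)) * exp (- (1 / t))
          + exp (- (1 / t)) * (- (- (1 / t\<^sup>2))) * poly p (1 / t)) (at t)"
        by (rule DERIV_mult)
      then show ?thesis
        by (rule DERIV_cong) (use 3 in \<open>simp add: flat_exp_def poly_monom power_one_over algebra_simps\<close>)
    qed
    ultimately show ?thesis by (rule has_real_derivative_cong_nhds)
  qed
qed

lemma smooth_real_flat_exp: "smooth_real (flat_exp p)"
  unfolding smooth_real_def
proof (intro exI conjI allI)
  let ?h = "\<lambda>m. flat_exp (((\<lambda>p. monom 1 2 * (p - pderiv p)) ^^ m) p)"
  show "?h 0 = flat_exp p" by simp
  show "(?h m has_real_derivative ?h (Suc m) t) (at t)" for m t
    using flat_exp_has_derivative by simp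
qed

lemma Cinf_on_compose_real: "smooth_real g \<Longrightarrow> Cinf_on n V f \<Longrightarrow> Cinf_on n V (\<lambda>x. g (f x))"
  unfolding smooth_real_def Cinf_on_def using Ck_on_compose_real[where m = 0] by blast

text \<open>With \<open>g = flat_exp 1\<close> and \<open>c = g (b - a)\<close> this is \<open>1 - g (c - g (b - t)) / g c\<close>. Let \<open>a < b\<close>.
For \<open>t \<le> a\<close> the inner value \<open>g (b - t)\<close> is at least \<open>c\<close>, which makes the outer \<open>g\<close> vanish; for
\<open>t \<ge> b\<close> the inner value is 0, which makes the quotient 1. Dividing by a constant only, it is
smooth as an iterated composition.\<close>

definition plateau :: "real \<Rightarrow> real \<Rightarrow> real \<Rightarrow> real" where
  "plateau a b t = 1 - flat_exp 1 (flat_exp 1 (b - a) - flat_exp 1 (b - t)) / flat_exp 1 (flat_exp 1 (b - a))"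

lemma flat_exp_1: "flat_exp 1 t = (if t > 0 then exp (- (1/t)) else 0)" by (simp add: flat_exp_def)

lemma plateau_eq_1: "a < b \<Longrightarrow> t \<le> a \<Longrightarrow> plateau a b t = 1"
  by (auto simp: plateau_def flat_exp_1 field_simps)

lemma plateau_eq_0: "a < b \<Longrightarrow> b \<le> t \<Longrightarrow> plateau a b t = 0"
  by (auto simp: plateau_def flat_exp_1)

lemma Cinf_on_const: "Cinf_on n V (\<lambda>_. c)"
  and Cinf_on_add: "Cinf_on n V f \<Longrightarrow> Cinf_on n V g \<Longrightarrow> Cinf_on n V (\<lambda>x. f x + g x)"
  and Cinf_on_mult: "Cinf_on n V f \<Longrightarrow> Cinf_on n V g \<Longrightarrow> Cinf_on n V (\<lambda>x. f x * g x)"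
  by (auto simp: Cinf_on_def Ck_on_const Ck_on_add Ck_on_mult)

lemma Cinf_on_plateau: assumes "Cinf_on n V f" shows "Cinf_on n V (\<lambda>x. plateau a b (f x))"
proof -
  have sub: "Cinf_on n V (\<lambda>x. c - g x)" if "Cinf_on n V g" for c g
    using Cinf_on_add[OF Cinf_on_const[of n V c] Cinf_on_mult[OF Cinf_on_const[of n V "-1"] that]] by simp
  have div: "Cinf_on n V (\<lambda>x. g x / c)" if "Cinf_on n V g" for c g
    using Cinf_on_mult[OF Cinf_on_const[of n V "1/c"] that] by simp
  show ?thesis unfolding plateau_def
    by (intro sub div Cinf_on_compose_real[OF smooth_real_flat_exp] assms)
qed

section \<open>Balls in the model space\<close>

lemma Euclidean_space_ball_in_open:
  assumes V: "openin (Euclidean_space n) V" and a: "a \<in> V"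
  obtains b :: real where "b > 0"
    "{x \<in> topspace (Euclidean_space n). (\<Sum>i<n. (x i - a i)\<^sup>2) \<le> b} \<subseteq> V"
proof -
  obtain T where T: "openin (powertop_real UNIV) T" and VT: "V = T \<inter> {x. \<forall>i\<ge>n. x i = 0}"
    using V unfolding Euclidean_space_def openin_subtopology by blast
  then obtain U where U: "\<And>i. open (U i)" "a \<in> Pi\<^sub>E UNIV U" "Pi\<^sub>E UNIV U \<subseteq> T"
    using a unfolding openin_product_topology_alt by (auto simp: VT dest!: bspec)
  have "\<exists>e>0. ball (a i) e \<subseteq> U i" for i
    using U(1)[of i] U(2) by (auto simp: open_contains_ball)
  then obtain d where d: "\<And>i. d i > 0" "\<And>i. ball (a i) (d i) \<subseteq> U i" by metis
  define e where "e = Min (insert 1 (d ` {..<n}))"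
  have e: "e > 0" "\<And>i. i < n \<Longrightarrow> e \<le> d i"
    using d(1) by (auto simp: e_def)
  have aH: "\<forall>i\<ge>n. a i = 0" using a VT by auto
  have "x \<in> V" if xH: "\<forall>i\<ge>n. x i = 0" and x: "(\<Sum>i<n. (x i - a i)\<^sup>2) \<le> (e / 2)\<^sup>2" for x
  proof -
    have "x i \<in> U i" for i
    proof (cases "i < n")
      case True
      then have "(x i - a i)\<^sup>2 \<le> (\<Sum>i<n. (x i - a i)\<^sup>2)"
        by (intro member_le_sum) auto
      with x have "(x i - a i)\<^sup>2 \<le> (e / 2)\<^sup>2" by linarith
      then have "\<bar>x i - a i\<bar> \<le> e / 2"
        using e(1) by (simp add: abs_le_square_iff[symmetric])
      then have "x i \<in> ball (a i) (d i)"
        using e(1) e(2)[OF True] by (simp add: dist_real_def abs_minus_commute)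
      then show ?thesis using d(2) by blast
    next
      case False
      then have "x i = a i" using xH aH by simp
      then show ?thesis using U(2) by (simp add: PiE_iff)
    qed
    then show ?thesis using U(3) xH VT by (auto simp: PiE_iff)
  qed
  then show ?thesis
    using that[of "(e/2)\<^sup>2"] e(1) by (auto simp: topspace_Euclidean_space)
qed

text \<open>A closed subset of a product of compact intervals, the factors from index \<open>n\<close> on being
\<open>{0}\<close>; Tychonoff's theorem applies.\<close>

lemma compactin_Euclidean_space_ball:
  "compactin (Euclidean_space n) {x \<in> topspace (Euclidean_space n). (\<Sum>i<n. (x i - a i)\<^sup>2) \<le> b}"
    (is "compactin _ ?K")
proof -
  let ?I = "\<lambda>i. if i < n then {a i - sqrt b .. a i + sqrt b} else {0}"
  have "closed {x :: nat \<Rightarrow> real. x i = 0}" for i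
    by (intro closed_Collect_eq continuous_intros continuous_on_product_coordinates)
  then have "closed (\<Inter>i\<in>{n..}. {x :: nat \<Rightarrow> real. x i = 0})" by blast
  moreover have "closed {x. (\<Sum>i<n. (x i - a i)\<^sup>2) \<le> b}"
    by (intro closed_Collect_le continuous_intros continuous_on_product_coordinates)
  moreover have "?K = (\<Inter>i\<in>{n..}. {x. x i = 0}) \<inter> {x. (\<Sum>i<n. (x i - a i)\<^sup>2) \<le> b}"
    by (auto simp: topspace_Euclidean_space)
  ultimately have "closedin (powertop_real UNIV) ?K"
    by (simp add: euclidean_product_topology closed_Int)
  moreover have "?K \<subseteq> Pi\<^sub>E UNIV ?I"
  proof
    fix x assume x: "x \<in> ?K"
    have "x i \<in> ?I i" for i
    proof (cases "i < n")
      case True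
      then have "(x i - a i)\<^sup>2 \<le> (\<Sum>i<n. (x i - a i)\<^sup>2)"
        by (intro member_le_sum) auto
      with x have "(x i - a i)\<^sup>2 \<le> b" by simp
      then have "\<bar>x i - a i\<bar> \<le> sqrt b" using real_sqrt_le_mono by fastforce
      with True show ?thesis by (simp add: abs_le_iff)
    qed (use x in \<open>simp add: topspace_Euclidean_space\<close>)
    then show "x \<in> Pi\<^sub>E UNIV ?I" by (simp add: PiE_iff)
  qed
  moreover have "compactin (powertop_real UNIV) (Pi\<^sub>E UNIV ?I)"
    unfolding compactin_PiE by auto
  ultimately have "compactin (powertop_real UNIV) ?K"
    using closed_compactin by blast
  then show ?thesis
    unfolding Euclidean_space_def compactin_subtopology by (auto simp: topspace_Euclidean_space)
qed

section \<open>Smooth functions on a manifold\<close>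

lemma chart_openin:
  assumes "smooth_manifold M" "(U, \<phi>) \<in> atlas M"
  shows "openin (mtop M) U" "openin (Euclidean_space (mdim M)) (\<phi> ` U)"
    "homeomorphic_map (subtopology (mtop M) U) (subtopology (Euclidean_space (mdim M)) (\<phi> ` U)) \<phi>"
  using assms unfolding smooth_manifold_def by auto

lemma chart_at:
  assumes "smooth_manifold M" "p \<in> points M"
  obtains U \<phi> where "(U, \<phi>) \<in> atlas M" "p \<in> U"
  using assms unfolding smooth_manifold_def by blast

lemma chart_inj_on:
  assumes "smooth_manifold M" "(U, \<phi>) \<in> atlas M"
  shows "inj_on \<phi> U"
  using homeomorphic_imp_injective_map[OF chart_openin(3)[OF assms]] openin_subset[OF chart_openin(1)[OF assms]]
  by (simp add: inf.absorb2)

lemma inv_chart_in: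
  assumes "smooth_manifold M" "(U, \<phi>) \<in> atlas M" "x \<in> \<phi> ` (U \<inter> W)"
  shows "inv_into U \<phi> x \<in> W"
  using assms chart_inj_on by (metis IntD1 IntD2 image_iff inv_into_f_f)

lemma chart_image_openin:
  assumes "smooth_manifold M" "(U, \<phi>) \<in> atlas M" "openin (mtop M) W"
  shows "openin (Euclidean_space (mdim M)) (\<phi> ` (U \<inter> W))"
proof -
  have "openin (subtopology (mtop M) U) (U \<inter> W)"
    using assms(3) by (metis inf.commute openin_subtopology_Int)
  then have "openin (subtopology (Euclidean_space (mdim M)) (\<phi> ` U)) (\<phi> ` (U \<inter> W))"
    using homeomorphic_imp_open_map[OF chart_openin(3)[OF assms(1,2)]] by (auto simp: open_map_def)
  then show ?thesis using chart_openin(2)[OF assms(1,2)] openin_trans_full by blast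
qed

lemma smooth_fun_on_subset:
  "smooth_fun_on M W f \<Longrightarrow> W' \<subseteq> W \<Longrightarrow> smooth_fun_on M W' f"
  unfolding smooth_fun_on_def Cinf_on_def by (fastforce elim!: Ck_on_subset)

lemma smooth_fun_on_cong:
  assumes M: "smooth_manifold M" and W: "openin (mtop M) W" and eq: "\<And>q. q \<in> W \<Longrightarrow> f q = g q"
    and f: "smooth_fun_on M W f"
  shows "smooth_fun_on M W g"
  unfolding smooth_fun_on_def Cinf_on_def
proof (clarify)
  fix U \<phi> k assume U: "(U, \<phi>) \<in> atlas M"
  show "Ck_on (mdim M) k (\<phi> ` (U \<inter> W)) (\<lambda>x. g (inv_into U \<phi> x))"
  proof (rule Ck_on_cong[OF chart_image_openin[OF M U W]])
    show "f (inv_into U \<phi> x) = g (inv_into U \<phi> x)" if "x \<in> \<phi> ` (U \<inter> W)" for x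
      by (rule eq) (rule inv_chart_in[OF M U that])
    show "Ck_on (mdim M) k (\<phi> ` (U \<inter> W)) (\<lambda>x. f (inv_into U \<phi> x))"
      using f U by (auto simp: smooth_fun_on_def Cinf_on_def)
  qed
qed

lemma smooth_fun_on_local:
  assumes M: "smooth_manifold M"
    and loc: "\<And>p. p \<in> W \<Longrightarrow> \<exists>N. openin (mtop M) N \<and> p \<in> N \<and> N \<subseteq> W \<and> smooth_fun_on M N f"
  shows "smooth_fun_on M W f"
  unfolding smooth_fun_on_def Cinf_on_def
proof (clarify)
  fix U \<phi> k assume U: "(U, \<phi>) \<in> atlas M"
  show "Ck_on (mdim M) k (\<phi> ` (U \<inter> W)) (\<lambda>x. f (inv_into U \<phi> x))"
  proof (rule Ck_on_local)
    fix x assume "x \<in> \<phi> ` (U \<inter> W)"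
    then obtain p where p: "p \<in> U" "p \<in> W" "x = \<phi> p" by blast
    then obtain N where N: "openin (mtop M) N" "p \<in> N" "N \<subseteq> W" "smooth_fun_on M N f"
      using loc by blast
    have "Ck_on (mdim M) k (\<phi> ` (U \<inter> N)) (\<lambda>x. f (inv_into U \<phi> x))"
      using N(4) U by (auto simp: smooth_fun_on_def Cinf_on_def)
    then show "\<exists>N'. openin (Euclidean_space (mdim M)) N' \<and> x \<in> N' \<and> N' \<subseteq> \<phi> ` (U \<inter> W) \<and>
        Ck_on (mdim M) k N' (\<lambda>x. f (inv_into U \<phi> x))"
      using chart_image_openin[OF M U N(1)] p N by blast
  qed
qed

lemma smooth_fun_on_const: "smooth_fun_on M W (\<lambda>_. c)"
  and smooth_fun_on_add: "smooth_fun_on M W f \<Longrightarrow> smooth_fun_on M W g \<Longrightarrow> smooth_fun_on M W (\<lambda>q. f q + g q)"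
  and smooth_fun_on_mult: "smooth_fun_on M W f \<Longrightarrow> smooth_fun_on M W g \<Longrightarrow> smooth_fun_on M W (\<lambda>q. f q * g q)"
  and smooth_fun_on_plateau: "smooth_fun_on M W f \<Longrightarrow> smooth_fun_on M W (\<lambda>q. plateau a b (f q))"
  unfolding smooth_fun_on_def by (auto intro: Cinf_on_const Cinf_on_add Cinf_on_mult Cinf_on_plateau)

lemma smooth_fun_on_diff:
  "smooth_fun_on M W f \<Longrightarrow> smooth_fun_on M W g \<Longrightarrow> smooth_fun_on M W (\<lambda>q. f q - g q)"
  using smooth_fun_on_add[of M W f "\<lambda>q. -1 * g q"] smooth_fun_on_mult[OF smooth_fun_on_const[of M W "-1"]]
  by simp

lemma smooth_fun_on_sum:
  "(\<And>i. i \<in> I \<Longrightarrow> smooth_fun_on M W (f i)) \<Longrightarrow> smooth_fun_on M W (\<lambda>q. \<Sum>i\<in>I. f i q)"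
  by (induction I rule: infinite_finite_induct) (auto intro: smooth_fun_on_const smooth_fun_on_add)

text \<open>Read in another chart, a chart coordinate is a component of a transition map.\<close>

lemma smooth_fun_on_chart_coordinate:
  assumes "smooth_manifold M" "(U, \<phi>) \<in> atlas M" "i < mdim M"
  shows "smooth_fun_on M U (\<lambda>q. \<phi> q i)"
proof -
  have "\<forall>(V, \<psi>)\<in>atlas M. \<forall>(U, \<phi>)\<in>atlas M. \<forall>i<mdim M.
      Cinf_on (mdim M) (\<psi> ` (V \<inter> U)) (\<lambda>x. \<phi> (inv_into V \<psi> x) i)"
    using assms(1) by (simp add: smooth_manifold_def)
  then show ?thesis using assms(2,3) unfolding smooth_fun_on_def by fast
qed

text \<open>The open sets \<open>W \<inter> V\<close> and \<open>V - C\<close> cover \<open>V\<close>, and smoothness is local. This is how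
local objects multiplied by a bump function become global.\<close>

lemma smooth_fun_on_extend_by_zero:
  assumes M: "smooth_manifold M" and W: "openin (mtop M) W" and V: "openin (mtop M) V"
    and C: "closedin (mtop M) C" "C \<subseteq> W"
    and g: "smooth_fun_on M (W \<inter> V) g" "\<And>q. q \<in> W \<inter> V \<Longrightarrow> h q = g q"
    and h: "\<And>q. q \<in> V - C \<Longrightarrow> h q = 0"
  shows "smooth_fun_on M V h"
proof (rule smooth_fun_on_local[OF M])
  fix p assume p: "p \<in> V"
  show "\<exists>N. openin (mtop M) N \<and> p \<in> N \<and> N \<subseteq> V \<and> smooth_fun_on M N h"
  proof (cases "p \<in> W")
    case True
    have o: "openin (mtop M) (W \<inter> V)" using W V by blast
    have "smooth_fun_on M (W \<inter> V) h"
      by (rule smooth_fun_on_cong[OF M o _ g(1)]) (simp add: g(2))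
    then show ?thesis using o p True by blast
  next
    case False
    have o: "openin (mtop M) (V - C)" using V C(1) by blast
    have "smooth_fun_on M (V - C) h"
      by (rule smooth_fun_on_cong[OF M o _ smooth_fun_on_const[of _ _ 0]]) (simp add: h)
    then show ?thesis using o p False C(2) by blast
  qed
qed

text \<open>The bump is a plateau function of \<open>r\<close>, the squared coordinate distance from \<open>p\<close>. Since \<open>r\<close>
is a polynomial in chart coordinates, which are smooth in every chart, only the chain rule for
an outer function of one variable is involved. The set \<open>C\<close> is the preimage of a compact
coordinate ball; being compact in a Hausdorff space it is closed in all of \<open>M\<close>.\<close>

lemma bump_function:
  assumes M: "smooth_manifold M" and W: "openin (mtop M) W" and p: "p \<in> W"
  obtains \<beta> N C where "\<beta> \<in> Cinf M" "openin (mtop M) N" "p \<in> N" "N \<subseteq> C" "closedin (mtop M) C" "C \<subseteq> W"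
    "\<And>q. q \<in> N \<Longrightarrow> \<beta> q = 1" "\<And>q. q \<notin> C \<Longrightarrow> \<beta> q = 0"
proof -
  have pM: "p \<in> points M" using openin_subset[OF W] p by blast
  obtain U \<phi> where U: "(U, \<phi>) \<in> atlas M" and pU: "p \<in> U" using chart_at[OF M pM] .
  note oU = chart_openin[OF M U]
  let ?n = "mdim M"
  define r where "r = (\<lambda>q. \<Sum>i<?n. (\<phi> q i - \<phi> p i)\<^sup>2)"
  obtain b where b: "b > 0" and
    bV: "{x \<in> topspace (Euclidean_space ?n). (\<Sum>i<?n. (x i - \<phi> p i)\<^sup>2) \<le> b} \<subseteq> \<phi> ` (U \<inter> W)" (is "?K \<subseteq> _")
    using Euclidean_space_ball_in_open[OF chart_image_openin[OF M U W], of "\<phi> p"] p pU by blast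
  have UE: "\<phi> ` U \<subseteq> topspace (Euclidean_space ?n)" using openin_subset[OF oU(2)] .
  define C where "C = {q \<in> U. r q \<le> b}"
  define N where "N = {q \<in> U. r q < b / 2}"
  have CK: "\<phi> ` C = ?K"
    using bV UE unfolding C_def r_def by auto
  have UM: "U \<subseteq> points M" using openin_subset[OF oU(1)] .
  have "compactin (subtopology (Euclidean_space ?n) (\<phi> ` U)) (\<phi> ` C)"
    using compactin_Euclidean_space_ball[of ?n "\<phi> p" b] unfolding CK[symmetric] compactin_subtopology
    by (auto simp: C_def)
  then have "compactin (subtopology (mtop M) U) C"
    using homeomorphic_map_compactness[OF oU(3), of C] UM by (auto simp: C_def)
  then have "compactin (mtop M) C" by (simp add: compactin_subtopology)
  moreover have "Hausdorff_space (mtop M)" using M by (simp add: smooth_manifold_def)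
  ultimately have C: "closedin (mtop M) C" by (simp add: compactin_imp_closedin)
  have CW: "C \<subseteq> W"
    using CK bV chart_inj_on[OF M U] unfolding C_def inj_on_def by blast
  have cm: "continuous_map (subtopology (mtop M) U) euclideanreal (\<lambda>q. \<phi> q i)" for i
    using homeomorphic_imp_continuous_map[OF oU(3)]
    unfolding Euclidean_space_def subtopology_subtopology continuous_map_in_subtopology continuous_map_componentwise_UNIV
    by blast
  have "continuous_map (subtopology (mtop M) U) euclideanreal r"
    unfolding r_def by (intro continuous_intros cm) simp
  then have "openin (subtopology (mtop M) U) {q \<in> topspace (subtopology (mtop M) U). r q \<in> {..<b/2}}"
    by (rule openin_continuous_map_preimage) simp
  moreover have "{q \<in> topspace (subtopology (mtop M) U). r q \<in> {..<b/2}} = N"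
    using UM by (auto simp: N_def)
  ultimately have N: "openin (mtop M) N" using openin_trans_full oU(1) by metis
  define \<beta> where "\<beta> = (\<lambda>q. if q \<in> U then plateau (b/2) b (r q) else 0)"
  have "smooth_fun_on M U (\<lambda>q. plateau (b/2) b (r q))"
    unfolding r_def power2_eq_square
    by (intro smooth_fun_on_plateau smooth_fun_on_sum smooth_fun_on_mult smooth_fun_on_diff
        smooth_fun_on_const smooth_fun_on_chart_coordinate[OF M U]) auto
  moreover have z: "\<beta> q = 0" if "q \<notin> C" for q
    using that b by (auto simp: \<beta>_def C_def intro!: plateau_eq_0)
  ultimately have "smooth_fun_on M (points M) \<beta>"
    by (intro smooth_fun_on_extend_by_zero[OF M oU(1) openin_topspace C])
      (auto simp: C_def \<beta>_def intro: smooth_fun_on_subset)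
  then have "\<beta> \<in> Cinf M" by (simp add: Cinf_def)
  moreover have "p \<in> N" using pU b by (simp add: N_def r_def)
  moreover have "N \<subseteq> C" using b by (auto simp: N_def C_def)
  moreover have "\<beta> q = 1" if "q \<in> N" for q
    using that b by (auto simp: \<beta>_def N_def intro!: plateau_eq_1)
  ultimately show ?thesis using N C CW z that by blast
qed

lemma smooth_germ_extends:
  assumes M: "smooth_manifold M" and f: "smooth_near M p f"
  obtains F N where "F \<in> Cinf M" "openin (mtop M) N" "p \<in> N" "\<And>q. q \<in> N \<Longrightarrow> F q = f q"
proof -
  obtain W where W: "openin (mtop M) W" "p \<in> W" "smooth_fun_on M W f"
    using f unfolding smooth_near_def by blast
  obtain \<beta> N C where b: "\<beta> \<in> Cinf M" "openin (mtop M) N" "p \<in> N" "N \<subseteq> C" "closedin (mtop M) C" "C \<subseteq> W"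
    "\<And>q. q \<in> N \<Longrightarrow> \<beta> q = 1" "\<And>q. q \<notin> C \<Longrightarrow> \<beta> q = 0"
    by (rule bump_function[OF M W(1,2)]) blast
  let ?F = "\<lambda>q. if q \<in> W then \<beta> q * f q else 0"
  have "smooth_fun_on M (W \<inter> points M) (\<lambda>q. \<beta> q * f q)"
    using b(1) W(3) by (auto simp: Cinf_def intro!: smooth_fun_on_mult elim: smooth_fun_on_subset)
  then have "smooth_fun_on M (points M) ?F"
    by (rule smooth_fun_on_extend_by_zero[OF M W(1) openin_topspace b(5,6)]) (auto simp: b(8))
  then have "?F \<in> Cinf M" by (simp add: Cinf_def)
  moreover have "?F q = f q" if "q \<in> N" for q using that b by auto
  ultimately show ?thesis using that b(2,3) by blast
qed

section \<open>Sections of a smooth vector bundle\<close>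

locale smooth_bundle =
  fixes M :: "'m manifold" and E :: "('m, 'e) vbundle"
  assumes manifold: "smooth_manifold M" and vector_bundle: "smooth_vector_bundle M E"
begin

lemma fibre_vector_space:
  "p \<in> points M \<Longrightarrow> real_vector_space_on (fibre E p) (fadd E) (fzero E p) (fscale E)"
  using vector_bundle by (simp add: smooth_vector_bundle_def)

lemma fzero_in: "p \<in> points M \<Longrightarrow> fzero E p \<in> fibre E p"
  and fadd_in: "p \<in> points M \<Longrightarrow> a \<in> fibre E p \<Longrightarrow> b \<in> fibre E p \<Longrightarrow> fadd E a b \<in> fibre E p"
  and fscale_in: "p \<in> points M \<Longrightarrow> a \<in> fibre E p \<Longrightarrow> fscale E c a \<in> fibre E p"
  using fibre_vector_space[of p] by (simp_all add: real_vector_space_on_def)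

lemma fadd_fzero:
  assumes "p \<in> points M" "a \<in> fibre E p"
  shows "fadd E (fzero E p) a = a"
proof -
  have "\<forall>a\<in>fibre E p. fadd E (fzero E p) a = a"
    using fibre_vector_space[OF assms(1)] unfolding real_vector_space_on_def by (elim conjE)
  with assms(2) show ?thesis by blast
qed

lemma
  assumes U: "(U, \<Phi>) \<in> trivs E"
  shows triv_openin: "openin (mtop M) U"
    and triv_bij: "p \<in> U \<Longrightarrow> bij_betw \<Phi> (fibre E p) (topspace (Euclidean_space (bundle_rank E)))"
    and triv_fadd: "p \<in> U \<Longrightarrow> a \<in> fibre E p \<Longrightarrow> b \<in> fibre E p \<Longrightarrow> \<Phi> (fadd E a b) i = \<Phi> a i + \<Phi> b i"
    and triv_fscale: "p \<in> U \<Longrightarrow> a \<in> fibre E p \<Longrightarrow> \<Phi> (fscale E c a) i = c * \<Phi> a i"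
    and triv_transition_smooth: "(V, \<Psi>) \<in> trivs E \<Longrightarrow> i < bundle_rank E \<Longrightarrow> j < bundle_rank E \<Longrightarrow>
      smooth_fun_on M (U \<inter> V) (\<lambda>p. \<Psi> (frame E \<Phi> j p) i)"
proof -
  have "\<forall>(U, \<Phi>)\<in>trivs E. openin (mtop M) U \<and>
        (\<forall>p\<in>U. bij_betw \<Phi> (fibre E p) (topspace (Euclidean_space (bundle_rank E))) \<and>
          (\<forall>a\<in>fibre E p. \<forall>b\<in>fibre E p. \<forall>i. \<Phi> (fadd E a b) i = \<Phi> a i + \<Phi> b i) \<and>
          (\<forall>c. \<forall>a\<in>fibre E p. \<forall>i. \<Phi> (fscale E c a) i = c * \<Phi> a i))"
    using vector_bundle unfolding smooth_vector_bundle_def by (elim conjE)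
  from bspec[OF this U]
  show "openin (mtop M) U"
    "p \<in> U \<Longrightarrow> bij_betw \<Phi> (fibre E p) (topspace (Euclidean_space (bundle_rank E)))"
    "p \<in> U \<Longrightarrow> a \<in> fibre E p \<Longrightarrow> b \<in> fibre E p \<Longrightarrow> \<Phi> (fadd E a b) i = \<Phi> a i + \<Phi> b i"
    "p \<in> U \<Longrightarrow> a \<in> fibre E p \<Longrightarrow> \<Phi> (fscale E c a) i = c * \<Phi> a i"
    unfolding prod.case by blast+
  have "\<forall>(U, \<Phi>)\<in>trivs E. \<forall>(V, \<Psi>)\<in>trivs E. \<forall>i<bundle_rank E. \<forall>j<bundle_rank E.
        smooth_fun_on M (U \<inter> V) (\<lambda>p. \<Psi> (frame E \<Phi> j p) i)"
    using vector_bundle unfolding smooth_vector_bundle_def by (elim conjE)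
  then show "(V, \<Psi>) \<in> trivs E \<Longrightarrow> i < bundle_rank E \<Longrightarrow> j < bundle_rank E \<Longrightarrow>
      smooth_fun_on M (U \<inter> V) (\<lambda>p. \<Psi> (frame E \<Phi> j p) i)" using U by fast
qed

lemma triv_at:
  assumes "p \<in> points M"
  obtains U \<Phi> where "(U, \<Phi>) \<in> trivs E" "p \<in> U"
proof -
  have "(\<Union>(U, \<Phi>)\<in>trivs E. U) = points M" using vector_bundle unfolding smooth_vector_bundle_def by (elim conjE)
  with assms that show ?thesis by fast
qed

lemma triv_in_points: "(U, \<Phi>) \<in> trivs E \<Longrightarrow> p \<in> U \<Longrightarrow> p \<in> points M"
  using openin_subset[OF triv_openin] by blast

lemma triv_fzero:
  assumes "(U, \<Phi>) \<in> trivs E" "p \<in> U"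
  shows "\<Phi> (fzero E p) i = 0"
proof -
  note p = triv_in_points[OF assms]
  have "\<Phi> (fzero E p) i = \<Phi> (fzero E p) i + \<Phi> (fzero E p) i"
    using triv_fadd[OF assms fzero_in[OF p] fzero_in[OF p]] fadd_fzero[OF p fzero_in[OF p]] by metis
  then show ?thesis by simp
qed

lemma triv_eqI:
  assumes "(U, \<Phi>) \<in> trivs E" "p \<in> U" "a \<in> fibre E p" "b \<in> fibre E p" "\<And>i. \<Phi> a i = \<Phi> b i"
  shows "a = b"
  using bij_betw_imp_inj_on[OF triv_bij[OF assms(1,2)]] assms(3-5) by (auto dest: inj_onD)

lemma triv_coordinate_eq_0:
  assumes "(U, \<Phi>) \<in> trivs E" "p \<in> U" "a \<in> fibre E p" "bundle_rank E \<le> i"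
  shows "\<Phi> a i = 0"
  using bij_betw_apply[OF triv_bij[OF assms(1,2)] assms(3)] assms(4) by (simp add: topspace_Euclidean_space)

lemma inv_triv:
  assumes "(U, \<Phi>) \<in> trivs E" "p \<in> U" "\<And>i. bundle_rank E \<le> i \<Longrightarrow> c i = 0"
  shows "inv_into (fibre E p) \<Phi> c \<in> fibre E p" "\<Phi> (inv_into (fibre E p) \<Phi> c) = c"
proof -
  have "c \<in> \<Phi> ` fibre E p"
    using bij_betw_imp_surj_on[OF triv_bij[OF assms(1,2)]] assms(3) by (simp add: topspace_Euclidean_space)
  then show "inv_into (fibre E p) \<Phi> c \<in> fibre E p" "\<Phi> (inv_into (fibre E p) \<Phi> c) = c"
    by (rule inv_into_into, rule f_inv_into_f)
qed

lemma frame_in: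
  assumes "(U, \<Phi>) \<in> trivs E" "p \<in> U" "j < bundle_rank E"
  shows "frame E \<Phi> j p \<in> fibre E p" "\<Phi> (frame E \<Phi> j p) = (\<lambda>i. if i = j then 1 else 0)"
  unfolding frame_def using inv_triv[OF assms(1,2), of "\<lambda>i. if i = j then 1 else 0"] assms(3) by auto

definition fibre_linear :: "'m \<Rightarrow> ('e \<Rightarrow> real) \<Rightarrow> bool" where
  "fibre_linear p L \<longleftrightarrow> (\<forall>a\<in>fibre E p. \<forall>b\<in>fibre E p. L (fadd E a b) = L a + L b) \<and>
     (\<forall>c. \<forall>a\<in>fibre E p. L (fscale E c a) = c * L a)"

lemma fibre_linear_triv: "(U, \<Phi>) \<in> trivs E \<Longrightarrow> p \<in> U \<Longrightarrow> fibre_linear p (\<lambda>a. \<Phi> a i)"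
  by (simp add: fibre_linear_def triv_fadd triv_fscale)

text \<open>A vector is the combination of the local frame with its coordinates as coefficients. The
fibres carry no type class structure in which to write that sum, so the coordinates are
split off one at a time, and the sum is taken only after \<open>L\<close> has been applied.\<close>

lemma fibre_linear_expansion:
  assumes U: "(U, \<Phi>) \<in> trivs E" "p \<in> U" and L: "fibre_linear p L" and a: "a \<in> fibre E p"
  shows "L a = (\<Sum>j<bundle_rank E. \<Phi> a j * L (frame E \<Phi> j p))"
proof -
  note p = triv_in_points[OF U]
  have "L a = (\<Sum>j<k. \<Phi> a j * L (frame E \<Phi> j p))"
    if "k \<le> bundle_rank E" "a \<in> fibre E p" "\<And>j. k \<le> j \<Longrightarrow> \<Phi> a j = 0" for k a
    using that
  proof (induction k arbitrary: a)
    case 0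
    have "fscale E 0 a = a"
      by (rule triv_eqI[OF U]) (use 0 in \<open>simp_all add: fscale_in[OF p] triv_fscale[OF U]\<close>)
    moreover have "L (fscale E 0 a) = 0 * L a" using L 0 unfolding fibre_linear_def by blast
    ultimately show ?case by simp
  next
    case (Suc k)
    define b where "b = inv_into (fibre E p) \<Phi> ((\<Phi> a)(k := 0))"
    define c where "c = fscale E (\<Phi> a k) (frame E \<Phi> k p)"
    have k: "k < bundle_rank E" using Suc.prems by simp
    have b: "b \<in> fibre E p" "\<Phi> b = (\<Phi> a)(k := 0)"
      unfolding b_def by (rule inv_triv[OF U]; use Suc.prems k in simp)+
    note fr = frame_in[OF U k]
    have c: "c \<in> fibre E p" unfolding c_def by (rule fscale_in[OF p fr(1)])
    have "\<Phi> c i = (if i = k then \<Phi> a k else 0)" for i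
      by (simp add: c_def triv_fscale[OF U fr(1)] fr(2))
    then have "fadd E b c = a"
      by (intro triv_eqI[OF U] fadd_in[OF p b(1) c] Suc.prems(2)) (simp add: triv_fadd[OF U b(1) c] b(2))
    then have "L a = L b + \<Phi> a k * L (frame E \<Phi> k p)"
      using L b(1) c fr(1) unfolding fibre_linear_def c_def by metis
    also have "L b = (\<Sum>j<k. \<Phi> b j * L (frame E \<Phi> j p))"
      by (rule Suc.IH) (use Suc.prems b k in \<open>auto simp: le_Suc_eq not_less_eq_eq\<close>)
    also have "\<dots> = (\<Sum>j<k. \<Phi> a j * L (frame E \<Phi> j p))"
      by (rule sum.cong) (simp_all add: b(2))
    finally show ?case by simp
  qed
  from this[OF order_refl a] triv_coordinate_eq_0[OF U a] show ?thesis by blast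
qed

text \<open>Smoothness of trivializations, metric and anchor is known only on local frames; this transfers
it to arbitrary sections.\<close>

lemma smooth_fibre_linear:
  assumes U: "(U, \<Phi>) \<in> trivs E" and N: "openin (mtop M) N" "N \<subseteq> U"
    and L: "\<And>p. p \<in> N \<Longrightarrow> fibre_linear p (L p)"
    and Lf: "\<And>j. j < bundle_rank E \<Longrightarrow> smooth_fun_on M N (\<lambda>p. L p (frame E \<Phi> j p))"
    and s: "\<And>p. p \<in> N \<Longrightarrow> s p \<in> fibre E p" "\<And>j. j < bundle_rank E \<Longrightarrow> smooth_fun_on M N (\<lambda>p. \<Phi> (s p) j)"
  shows "smooth_fun_on M N (\<lambda>p. L p (s p))"
proof (rule smooth_fun_on_cong[OF manifold N(1)])
  show "smooth_fun_on M N (\<lambda>p. \<Sum>j<bundle_rank E. \<Phi> (s p) j * L p (frame E \<Phi> j p))"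
    by (intro smooth_fun_on_sum smooth_fun_on_mult Lf s(2)) auto
  show "(\<Sum>j<bundle_rank E. \<Phi> (s p) j * L p (frame E \<Phi> j p)) = L p (s p)" if "p \<in> N" for p
    using fibre_linear_expansion[OF U _ L[OF that] s(1)[OF that]] N(2) that by auto
qed

lemma section_in: "s \<in> sections M E \<Longrightarrow> p \<in> points M \<Longrightarrow> s p \<in> fibre E p"
  and section_ext: "s \<in> sections M E \<Longrightarrow> s \<in> extensional (points M)"
  by (auto simp: sections_def)

lemma section_smooth:
  assumes "s \<in> sections M E" "(U, \<Phi>) \<in> trivs E"
  shows "smooth_fun_on M U (\<lambda>p. \<Phi> (s p) i)"
proof (cases "i < bundle_rank E")
  case True
  then show ?thesis using assms by (auto simp: sections_def)
next
  case False
  show ?thesis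
    by (rule smooth_fun_on_cong[OF manifold triv_openin[OF assms(2)] _ smooth_fun_on_const[of _ _ 0]])
      (use False triv_coordinate_eq_0[OF assms(2) _ section_in[OF assms(1)]] triv_in_points[OF assms(2)] in auto)
qed

lemma sectionsI:
  assumes "s \<in> extensional (points M)" "\<And>p. p \<in> points M \<Longrightarrow> s p \<in> fibre E p"
    "\<And>U \<Phi> i. (U, \<Phi>) \<in> trivs E \<Longrightarrow> i < bundle_rank E \<Longrightarrow> smooth_fun_on M U (\<lambda>p. \<Phi> (s p) i)"
  shows "s \<in> sections M E"
  using assms by (auto simp: sections_def)

lemma fmult_section:
  assumes "f \<in> Cinf M" "x \<in> sections M E"
  shows "fmult M E f x \<in> sections M E"
proof -
  have "smooth_fun_on M U (\<lambda>p. \<Phi> (fmult M E f x p) i)" if U: "(U, \<Phi>) \<in> trivs E" for U \<Phi> i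
  proof (rule smooth_fun_on_cong[OF manifold triv_openin[OF U]])
    show "smooth_fun_on M U (\<lambda>p. f p * \<Phi> (x p) i)"
      using assms(1) openin_subset[OF triv_openin[OF U]]
      by (intro smooth_fun_on_mult section_smooth[OF assms(2) U]) (auto simp: Cinf_def elim: smooth_fun_on_subset)
  qed (simp add: fmult_def triv_in_points[OF U] triv_fscale[OF U] section_in assms)
  then show ?thesis by (intro sectionsI) (simp_all add: fmult_def fscale_in section_in assms)
qed

text \<open>Multiply the local section with constant coordinates by a bump function.\<close>

lemma section_with_constant_coordinates:
  assumes U: "(U, \<Phi>) \<in> trivs E" and p: "p \<in> U" and c: "\<And>i. bundle_rank E \<le> i \<Longrightarrow> c i = 0"
  obtains s N where "s \<in> sections M E" "openin (mtop M) N" "p \<in> N" "N \<subseteq> U" "\<And>q. q \<in> N \<Longrightarrow> \<Phi> (s q) = c"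
proof -
  obtain \<beta> N C where b: "\<beta> \<in> Cinf M" "openin (mtop M) N" "p \<in> N" "N \<subseteq> C" "closedin (mtop M) C" "C \<subseteq> U"
    "\<And>q. q \<in> N \<Longrightarrow> \<beta> q = 1" "\<And>q. q \<notin> C \<Longrightarrow> \<beta> q = 0"
    by (rule bump_function[OF manifold triv_openin[OF U] p]) blast
  define e where "e = (\<lambda>q. inv_into (fibre E q) \<Phi> c)"
  have e: "e q \<in> fibre E q" "\<Phi> (e q) = c" if "q \<in> U" for q
    using inv_triv[OF U that, of c] c unfolding e_def by blast+
  define s where "s = (\<lambda>q\<in>points M. if q \<in> U then fscale E (\<beta> q) (e q) else fzero E q)"
  have "smooth_fun_on M V (\<lambda>q. \<Psi> (s q) i)" if V: "(V, \<Psi>) \<in> trivs E" and i: "i < bundle_rank E" for V \<Psi> i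
  proof (rule smooth_fun_on_extend_by_zero[OF manifold triv_openin[OF U] triv_openin[OF V] b(5,6)])
    have o: "openin (mtop M) (U \<inter> V)" using triv_openin[OF U] triv_openin[OF V] by blast
    have "smooth_fun_on M (U \<inter> V) (\<lambda>q. \<Psi> (e q) i)"
    proof (rule smooth_fibre_linear[OF U o])
      show "smooth_fun_on M (U \<inter> V) (\<lambda>q. \<Phi> (e q) j)" for j
        by (rule smooth_fun_on_cong[OF manifold o _ smooth_fun_on_const[of _ _ "c j"]]) (simp add: e)
    qed (use e in \<open>simp_all add: fibre_linear_triv[OF V] triv_transition_smooth[OF U V i]\<close>)
    then show "smooth_fun_on M (U \<inter> V) (\<lambda>q. \<beta> q * \<Psi> (e q) i)"
      using b(1) openin_subset[OF o] by (intro smooth_fun_on_mult) (auto simp: Cinf_def elim: smooth_fun_on_subset)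
    show "\<Psi> (s q) i = \<beta> q * \<Psi> (e q) i" if "q \<in> U \<inter> V" for q
      using that triv_in_points[OF U] by (simp add: s_def triv_fscale[OF V, of q] e)
    show "\<Psi> (s q) i = 0" if "q \<in> V - C" for q
      using that triv_in_points[OF V] by (simp add: s_def triv_fscale[OF V, of q] e triv_fzero[OF V, of q] b(8))
  qed
  then have "s \<in> sections M E"
    by (intro sectionsI) (simp_all add: s_def fscale_in e fzero_in)
  moreover have "\<Phi> (s q) = c" if "q \<in> N" for q
  proof -
    have q: "q \<in> U" using that b by blast
    show ?thesis
      by (rule ext) (use q that in \<open>simp add: s_def triv_in_points[OF U] triv_fscale[OF U q] e b(7)\<close>)
  qed
  ultimately show ?thesis using that b(2-4,6) by blast
qed

lemma section_through:
  assumes p: "p \<in> points M" and a: "a \<in> fibre E p"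
  obtains s where "s \<in> sections M E" "s p = a"
proof -
  obtain U \<Phi> where U: "(U, \<Phi>) \<in> trivs E" "p \<in> U" using triv_at[OF p] .
  obtain s N where s: "s \<in> sections M E" "p \<in> N" "\<And>q. q \<in> N \<Longrightarrow> \<Phi> (s q) = \<Phi> a"
    by (rule section_with_constant_coordinates[OF U, of "\<Phi> a"]) (use triv_coordinate_eq_0[OF U a] in blast)+
  have "s p = a" by (rule triv_eqI[OF U section_in[OF s(1) p] a]) (simp add: s)
  with s(1) show ?thesis using that by blast
qed

lemma
  assumes B: "fibre_metric M E B" and p: "p \<in> points M" and c: "c \<in> fibre E p"
  shows fibre_metric_commute: "a \<in> fibre E p \<Longrightarrow> B a c = B c a"
    and fibre_metric_linear_left: "fibre_linear p (\<lambda>a. B a c)"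
    and fibre_metric_linear_right: "fibre_linear p (B c)"
proof -
  show *: "B a c = B c a" if "a \<in> fibre E p" for a
    using B p c that unfolding fibre_metric_def by blast
  show lin: "fibre_linear p (\<lambda>a. B a c)"
    using B p c unfolding fibre_metric_def fibre_linear_def by blast
  show "fibre_linear p (B c)"
    using lin unfolding fibre_linear_def by (simp add: *[symmetric] fadd_in[OF p] fscale_in[OF p])
qed

lemma fibre_metric_sections_smooth:
  assumes B: "fibre_metric M E B" and u: "u \<in> sections M E" and v: "v \<in> sections M E"
  shows "(\<lambda>q. B (u q) (v q)) \<in> Cinf M"
proof -
  note lin = fibre_metric_linear_left[OF B] and sym = fibre_metric_commute[OF B]
  have frames: "\<forall>(U, \<Phi>)\<in>trivs E. \<forall>i<bundle_rank E. \<forall>j<bundle_rank E.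
      smooth_fun_on M U (\<lambda>p. B (frame E \<Phi> i p) (frame E \<Phi> j p))"
    using B unfolding fibre_metric_def by (elim conjE)
  have on_triv: "smooth_fun_on M U (\<lambda>q. B (u q) (v q))" if U: "(U, \<Phi>) \<in> trivs E" for U \<Phi>
  proof (rule smooth_fibre_linear[OF U triv_openin[OF U] subset_refl, where L = "\<lambda>q a. B a (v q)"])
    fix j assume j: "j < bundle_rank E"
    have "smooth_fun_on M U (\<lambda>q. B (v q) (frame E \<Phi> j q))"
    proof (rule smooth_fibre_linear[OF U triv_openin[OF U] subset_refl, where L = "\<lambda>q a. B a (frame E \<Phi> j q)"])
      show "smooth_fun_on M U (\<lambda>q. B (frame E \<Phi> i q) (frame E \<Phi> j q))" if "i < bundle_rank E" for i
        using frames U j that by fast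
    qed (simp_all add: lin triv_in_points[OF U] frame_in[OF U _ j] section_in v section_smooth[OF v U])
    then show "smooth_fun_on M U (\<lambda>q. B (frame E \<Phi> j q) (v q))"
    proof (rule smooth_fun_on_cong[OF manifold triv_openin[OF U], rotated])
      fix q assume q: "q \<in> U"
      note qM = triv_in_points[OF U q]
      show "B (v q) (frame E \<Phi> j q) = B (frame E \<Phi> j q) (v q)"
        by (rule sym[OF qM frame_in(1)[OF U q j] section_in[OF v qM]])
    qed
  qed (simp_all add: lin triv_in_points[OF U] section_in u v section_smooth[OF u U])
  have "smooth_fun_on M (points M) (\<lambda>q. B (u q) (v q))"
  proof (rule smooth_fun_on_local[OF manifold])
    fix p assume "p \<in> points M"
    then obtain U \<Phi> where U: "(U, \<Phi>) \<in> trivs E" "p \<in> U" by (rule triv_at)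
    show "\<exists>N. openin (mtop M) N \<and> p \<in> N \<and> N \<subseteq> points M \<and> smooth_fun_on M N (\<lambda>q. B (u q) (v q))"
      using on_triv[OF U(1)] triv_openin[OF U(1)] openin_subset[OF triv_openin[OF U(1)]] U(2) by blast
  qed
  then show ?thesis by (simp add: Cinf_def)
qed

text \<open>Non-degeneracy concerns all vectors of one fibre. It may be tested against global sections
because each vector is a value of one.\<close>

lemma fibre_metric_cancel:
  assumes B: "fibre_metric M E B" and p: "p \<in> points M" and a: "a \<in> fibre E p" and b: "b \<in> fibre E p"
    and eq: "\<And>u. u \<in> sections M E \<Longrightarrow> B (u p) a = B (u p) b"
  shows "a = b"
proof -
  note lin = fibre_metric_linear_left[OF B p] and sym = fibre_metric_commute[OF B p]
  define d where "d = fadd E a (fscale E (- 1) b)"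
  note mb = fscale_in[OF p b, of "- 1"]
  have d: "d \<in> fibre E p" unfolding d_def by (rule fadd_in[OF p a mb])
  have "B d c = 0" if c: "c \<in> fibre E p" for c
  proof -
    obtain u where u: "u \<in> sections M E" "u p = c" using section_through[OF p c] .
    have "B d c = B a c + (- 1) * B b c"
      using lin[OF c] a b mb unfolding d_def fibre_linear_def by metis
    also have "B a c = B b c" using eq[OF u(1)] sym a b c u(2) by metis
    finally show ?thesis by simp
  qed
  then have d0: "d = fzero E p" using B p d unfolding fibre_metric_def by blast
  obtain U \<Phi> where U: "(U, \<Phi>) \<in> trivs E" "p \<in> U" using triv_at[OF p] .
  show ?thesis
  proof (rule triv_eqI[OF U a b])
    fix i
    have "\<Phi> d i = \<Phi> a i + - 1 * \<Phi> b i"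
      unfolding d_def by (simp only: triv_fadd[OF U a mb] triv_fscale[OF U b])
    then show "\<Phi> a i = \<Phi> b i" unfolding d0 triv_fzero[OF U] by simp
  qed
qed

end

section \<open>Derivations and the tangent bundle\<close>

lemma derivation_at_cong:
  "derivation_at M p D \<Longrightarrow> smooth_near M p f \<Longrightarrow> smooth_near M p g \<Longrightarrow> openin (mtop M) W \<Longrightarrow> p \<in> W \<Longrightarrow>
    (\<And>q. q \<in> W \<Longrightarrow> f q = g q) \<Longrightarrow> D f = D g"
  unfolding derivation_at_def by blast

lemma derivation_at_mult:
  "derivation_at M p D \<Longrightarrow> smooth_near M p f \<Longrightarrow> smooth_near M p g \<Longrightarrow>
    D (\<lambda>q. f q * g q) = D f * g p + f p * D g"
  unfolding derivation_at_def by blast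

lemma Cinf_smooth_near: "f \<in> Cinf M \<Longrightarrow> p \<in> points M \<Longrightarrow> smooth_near M p f"
  unfolding Cinf_def smooth_near_def by blast

lemma Cinf_mult: "f \<in> Cinf M \<Longrightarrow> g \<in> Cinf M \<Longrightarrow> (\<lambda>q. f q * g q) \<in> Cinf M"
  by (simp add: Cinf_def smooth_fun_on_mult)

lemma smooth_near_cong:
  assumes "smooth_manifold M" "smooth_near M p f" "openin (mtop M) W" "p \<in> W" "\<And>q. q \<in> W \<Longrightarrow> f q = g q"
  shows "smooth_near M p g"
proof -
  obtain V where V: "openin (mtop M) V" "p \<in> V" "smooth_fun_on M V f"
    using assms(2) unfolding smooth_near_def by blast
  have o: "openin (mtop M) (V \<inter> W)" using V assms(3) by blast
  have "smooth_fun_on M (V \<inter> W) g"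
    by (rule smooth_fun_on_cong[OF assms(1) o _ smooth_fun_on_subset[OF V(3)]]) (use assms(5) in auto)
  then show ?thesis using o V(2) assms(4) unfolding smooth_near_def by blast
qed

lemma fibre_tangent_bundle: "v \<in> fibre (tangent_bundle M) p \<longleftrightarrow> p \<in> points M \<and> fst v = p \<and> derivation_at M p (snd v)"
  by (auto simp: fibre_def tangent_bundle_def)

lemma fadd_tangent_bundle: "fadd (tangent_bundle M) v w = (fst v, \<lambda>f. snd v f + snd w f)"
  and fscale_tangent_bundle: "fscale (tangent_bundle M) c v = (fst v, \<lambda>f. c * snd v f)"
  and bundle_rank_tangent_bundle: "bundle_rank (tangent_bundle M) = mdim M"
  by (simp_all add: tangent_bundle_def)

lemma trivs_tangent_bundle: "trivs (tangent_bundle M) =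
    (\<lambda>(U, \<phi>). (U, \<lambda>v i. if i < mdim M then snd v (\<lambda>q. \<phi> q i) else 0)) ` atlas M"
  by (simp add: tangent_bundle_def)

section \<open>The Leibniz rule and the anchor\<close>

locale courant =
  fixes M :: "'m manifold" and E :: "('m, 'e) vbundle"
    and br :: "('m \<Rightarrow> 'e) \<Rightarrow> ('m \<Rightarrow> 'e) \<Rightarrow> 'm \<Rightarrow> 'e"
    and \<rho> :: "'e \<Rightarrow> 'm \<times> (('m \<Rightarrow> real) \<Rightarrow> real)"
    and B :: "'e \<Rightarrow> 'e \<Rightarrow> real"
  assumes courant: "courant_algebroid M E br \<rho> B"
begin

sublocale smooth_bundle M E
  using courant by unfold_locales (simp_all add: courant_algebroid_def)

abbreviation der :: "('m \<Rightarrow> 'e) \<Rightarrow> ('m \<Rightarrow> real) \<Rightarrow> 'm \<Rightarrow> real" where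
  "der x f \<equiv> vf_apply (on_sections M \<rho> x) f"

lemma anchor_morphism: "vbundle_morphism M E (tangent_bundle M) \<rho>"
  and metric: "fibre_metric M E B"
  and loday: "loday_bracket M E br"
  using courant by (simp_all add: courant_algebroid_def)

lemma bracket_metric_invariant:
  "x \<in> sections M E \<Longrightarrow> u \<in> sections M E \<Longrightarrow> v \<in> sections M E \<Longrightarrow> p \<in> points M \<Longrightarrow>
    der x (\<lambda>q. B (u q) (v q)) p = B (br x u p) (v p) + B (u p) (br x v p)"
  using courant unfolding courant_algebroid_def by blast

lemma bracket_section: "x \<in> sections M E \<Longrightarrow> y \<in> sections M E \<Longrightarrow> br x y \<in> sections M E"
  and bracket_sadd: "x \<in> sections M E \<Longrightarrow> y \<in> sections M E \<Longrightarrow> z \<in> sections M E \<Longrightarrow>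
    br x (sadd M E y z) = sadd M E (br x y) (br x z)"
  and jacobi: "x \<in> sections M E \<Longrightarrow> y \<in> sections M E \<Longrightarrow> z \<in> sections M E \<Longrightarrow>
    br x (br y z) = sadd M E (br (br x y) z) (br y (br x z))"
  using loday unfolding loday_bracket_def by blast+

lemma anchor_fadd: "p \<in> points M \<Longrightarrow> a \<in> fibre E p \<Longrightarrow> b \<in> fibre E p \<Longrightarrow>
    \<rho> (fadd E a b) = fadd (tangent_bundle M) (\<rho> a) (\<rho> b)"
  and anchor_fscale: "p \<in> points M \<Longrightarrow> a \<in> fibre E p \<Longrightarrow> \<rho> (fscale E c a) = fscale (tangent_bundle M) c (\<rho> a)"
  and anchor_in: "p \<in> points M \<Longrightarrow> a \<in> fibre E p \<Longrightarrow> \<rho> a \<in> fibre (tangent_bundle M) p"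
  using anchor_morphism unfolding vbundle_morphism_def by blast+

lemma fst_anchor: "p \<in> points M \<Longrightarrow> a \<in> fibre E p \<Longrightarrow> fst (\<rho> a) = p"
  and anchor_derivation: "p \<in> points M \<Longrightarrow> a \<in> fibre E p \<Longrightarrow> derivation_at M p (snd (\<rho> a))"
  using anchor_in by (auto simp: fibre_tangent_bundle)

lemma fibre_linear_anchor: "p \<in> points M \<Longrightarrow> fibre_linear p (\<lambda>a. snd (\<rho> a) f)"
  by (simp add: fibre_linear_def anchor_fadd anchor_fscale fadd_tangent_bundle fscale_tangent_bundle)

lemma der_eq: "p \<in> points M \<Longrightarrow> der x f p = snd (\<rho> (x p)) f"
  by (simp add: vf_apply_def on_sections_def)

text \<open>Pair with an arbitrary section \<open>u\<close> and compute \<open>\<rho>(x)(u|fy)\<close> twice: by invariance of the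
form it is \<open>([x,u]|fy) + (u|[x,fy])\<close>; by the product rule it is
\<open>(\<rho>(x)f)(u|y) + f \<rho>(x)(u|y)\<close>, where invariance expands the last term as
\<open>f([x,u]|y) + f(u|[x,y])\<close>. The terms with \<open>[x,u]\<close> cancel, and non-degeneracy removes
\<open>u\<close>.\<close>

lemma leibniz_at:
  assumes x: "x \<in> sections M E" and y: "y \<in> sections M E" and f: "f \<in> Cinf M" and p: "p \<in> points M"
  shows "br x (fmult M E f y) p = fadd E (fscale E (f p) (br x y p)) (fscale E (der x f p) (y p))"
proof (rule fibre_metric_cancel[OF metric p])
  have fy: "fmult M E f y \<in> sections M E" by (rule fmult_section[OF f y])
  have xy: "br x y p \<in> fibre E p" "y p \<in> fibre E p" "br x (fmult M E f y) p \<in> fibre E p"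
    by (simp_all add: section_in bracket_section x y fy p)
  then show "br x (fmult M E f y) p \<in> fibre E p"
    "fadd E (fscale E (f p) (br x y p)) (fscale E (der x f p) (y p)) \<in> fibre E p"
    by (simp_all add: fadd_in[OF p] fscale_in[OF p])
  fix u assume u: "u \<in> sections M E"
  have lin: "fibre_linear q (B (u q))" if "q \<in> points M" for q
    by (rule fibre_metric_linear_right[OF metric that section_in[OF u that]])
  have D: "derivation_at M p (snd (\<rho> (x p)))" by (rule anchor_derivation[OF p section_in[OF x p]])
  have uv: "(\<lambda>q. B (u q) (y q)) \<in> Cinf M" "(\<lambda>q. B (u q) (fmult M E f y q)) \<in> Cinf M"
    by (rule fibre_metric_sections_smooth[OF metric u]; fact)+
  have "der x (\<lambda>q. B (u q) (fmult M E f y q)) p = snd (\<rho> (x p)) (\<lambda>q. f q * B (u q) (y q))"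
    unfolding der_eq[OF p]
  proof (rule derivation_at_cong[OF D _ _ openin_topspace p])
    show "B (u q) (fmult M E f y q) = f q * B (u q) (y q)" if "q \<in> points M" for q
      using lin[OF that] section_in[OF y that] that by (simp add: fmult_def fibre_linear_def)
  qed (intro Cinf_smooth_near Cinf_mult f uv p)+
  also have "\<dots> = der x f p * B (u p) (y p) + f p * der x (\<lambda>q. B (u q) (y q)) p"
    unfolding der_eq[OF p] by (rule derivation_at_mult[OF D Cinf_smooth_near[OF f p] Cinf_smooth_near[OF uv(1) p]])
  also have "der x (\<lambda>q. B (u q) (y q)) p = B (br x u p) (y p) + B (u p) (br x y p)"
    by (rule bracket_metric_invariant[OF x u y p])
  also have "der x (\<lambda>q. B (u q) (fmult M E f y q)) p
      = B (br x u p) (fmult M E f y p) + B (u p) (br x (fmult M E f y) p)"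
    by (rule bracket_metric_invariant[OF x u fy p])
  also have "B (br x u p) (fmult M E f y p) = f p * B (br x u p) (y p)"
    using fibre_metric_linear_right[OF metric p section_in[OF bracket_section[OF x u] p]] xy(2) p
    by (simp add: fibre_linear_def fmult_def)
  finally have "B (u p) (br x (fmult M E f y) p) = f p * B (u p) (br x y p) + der x f p * B (u p) (y p)"
    by (simp add: algebra_simps)
  also have "\<dots> = B (u p) (fadd E (fscale E (f p) (br x y p)) (fscale E (der x f p) (y p)))"
    using lin[OF p] xy fscale_in[OF p] unfolding fibre_linear_def by metis
  finally show "B (u p) (br x (fmult M E f y) p)
    = B (u p) (fadd E (fscale E (f p) (br x y p)) (fscale E (der x f p) (y p)))" .
qed

theorem leibniz_rule:
  assumes "x \<in> sections M E" "y \<in> sections M E" "f \<in> Cinf M"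
  shows "br x (fmult M E f y) = sadd M E (fmult M E f (br x y)) (fmult M E (der x f) y)"
proof (rule extensionalityI)
  show "br x (fmult M E f y) \<in> extensional (points M)"
    using assms by (intro section_ext bracket_section fmult_section)
  fix p assume p: "p \<in> points M"
  show "br x (fmult M E f y) p = sadd M E (fmult M E f (br x y)) (fmult M E (der x f) y) p"
    unfolding leibniz_at[OF assms p] by (simp add: sadd_def fmult_def p)
qed (simp add: sadd_def)

text \<open>A bundle of rank 0 has no nowhere vanishing local section, which the arguments below use;
its anchor, however, is zero.\<close>

lemma anchor_rank_0:
  assumes "bundle_rank E = 0" "p \<in> points M" "a \<in> fibre E p"
  shows "snd (\<rho> a) f = 0"
proof -
  obtain U \<Phi> where U: "(U, \<Phi>) \<in> trivs E" "p \<in> U" using triv_at[OF assms(2)] .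
  show ?thesis
    using fibre_linear_expansion[OF U fibre_linear_anchor[OF assms(2)] assms(3)] assms(1) by simp
qed

lemma unit_section:
  assumes U: "(U, \<Phi>) \<in> trivs E" "p \<in> U" and r: "bundle_rank E > 0"
  obtains v N where "v \<in> sections M E" "openin (mtop M) N" "p \<in> N" "N \<subseteq> U" "\<And>q. q \<in> N \<Longrightarrow> \<Phi> (v q) 0 = 1"
  by (rule section_with_constant_coordinates[OF U, of "\<lambda>i. if i = 0 then 1 else 0"]) (use r that in auto)

lemma leibniz_coordinate:
  assumes "x \<in> sections M E" "y \<in> sections M E" "f \<in> Cinf M" and U: "(U, \<Phi>) \<in> trivs E" "p \<in> U"
  shows "\<Phi> (br x (fmult M E f y) p) i = f p * \<Phi> (br x y p) i + der x f p * \<Phi> (y p) i"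
  using triv_in_points[OF U]
  by (simp add: leibniz_at assms(1-3) triv_fadd[OF U] triv_fscale[OF U] fscale_in section_in bracket_section)

text \<open>By the Leibniz rule \<open>(\<rho>(y)f) v = [y,fv] - f[y,v]\<close> is a section for every section \<open>v\<close>. If a
coordinate of \<open>v\<close> is 1 near a point, the same coordinate of the right-hand side is \<open>\<rho>(y)f\<close>
there.\<close>

lemma der_smooth:
  assumes y: "y \<in> sections M E" and f: "f \<in> Cinf M"
  shows "der y f \<in> Cinf M"
proof -
  have "smooth_fun_on M (points M) (der y f)"
  proof (rule smooth_fun_on_local[OF manifold])
    fix p assume p: "p \<in> points M"
    obtain U \<Phi> where U: "(U, \<Phi>) \<in> trivs E" "p \<in> U" using triv_at[OF p] .
    show "\<exists>N. openin (mtop M) N \<and> p \<in> N \<and> N \<subseteq> points M \<and> smooth_fun_on M N (der y f)"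
    proof (cases "bundle_rank E = 0")
      case True
      have "smooth_fun_on M (points M) (der y f)"
        by (rule smooth_fun_on_cong[OF manifold openin_topspace _ smooth_fun_on_const[of _ _ 0]])
          (simp add: der_eq anchor_rank_0[OF True] section_in y)
      then show ?thesis using p by blast
    next
      case False
      then obtain v N where v: "v \<in> sections M E" and N: "openin (mtop M) N" "p \<in> N" "N \<subseteq> U"
        and v1: "\<And>q. q \<in> N \<Longrightarrow> \<Phi> (v q) 0 = 1"
        using unit_section[OF U] by blast
      have NM: "N \<subseteq> points M" by (rule openin_subset[OF N(1)])
      have fv: "fmult M E f v \<in> sections M E" by (rule fmult_section[OF f v])
      have "smooth_fun_on M N (\<lambda>q. \<Phi> (br y (fmult M E f v) q) 0 - f q * \<Phi> (br y v q) 0)"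
        using f NM N(3)
        by (intro smooth_fun_on_diff smooth_fun_on_mult
            smooth_fun_on_subset[OF section_smooth[OF bracket_section[OF y fv] U(1)]]
            smooth_fun_on_subset[OF section_smooth[OF bracket_section[OF y v] U(1)]])
          (auto simp: Cinf_def elim: smooth_fun_on_subset)
      then have "smooth_fun_on M N (der y f)"
        by (rule smooth_fun_on_cong[OF manifold N(1), rotated])
          (use N(3) leibniz_coordinate[OF y v f U(1)] v1 in auto)
      then show ?thesis using N(1,2) NM by blast
    qed
  qed
  then show ?thesis by (simp add: Cinf_def)
qed

text \<open>Expand \<open>[x,[y,fv]]\<close> and \<open>[y,[x,fv]]\<close> by the Leibniz rule. In their difference the terms
with first derivatives of \<open>f\<close> cancel. What remains is \<open>(\<rho>(x)\<rho>(y)f - \<rho>(y)\<rho>(x)f) v\<close> and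
\<open>f\<close> times \<open>[x,[y,v]] - [y,[x,v]] = [[x,y],v]\<close>. By the Jacobi identity the
difference is also \<open>[[x,y],fv] = f[[x,y],v] + (\<rho>([x,y])f) v\<close>. Take a
section \<open>v\<close> with a coordinate equal to 1.\<close>

lemma der_bracket:
  assumes x: "x \<in> sections M E" and y: "y \<in> sections M E" and f: "f \<in> Cinf M" and p: "p \<in> points M"
  shows "der (br x y) f p = der x (der y f) p - der y (der x f) p"
proof (cases "bundle_rank E = 0")
  case True
  have "snd (\<rho> (z p)) g = 0" if "z \<in> sections M E" for z g
    by (rule anchor_rank_0[OF True p section_in[OF that p]])
  then show ?thesis by (simp add: der_eq[OF p] x y bracket_section)
next
  case False
  obtain U \<Phi> where U: "(U, \<Phi>) \<in> trivs E" "p \<in> U" using triv_at[OF p] .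
  from False have r: "bundle_rank E > 0" by simp
  obtain v N where v: "v \<in> sections M E" and "openin (mtop M) N" and pN: "p \<in> N" and "N \<subseteq> U"
    and N1: "\<And>q. q \<in> N \<Longrightarrow> \<Phi> (v q) 0 = 1"
    by (rule unit_section[OF U r]) blast
  note v1 = N1[OF pN]
  have twice: "\<Phi> (br x (br y (fmult M E f v)) p) 0
      = f p * \<Phi> (br x (br y v) p) 0 + der x f p * \<Phi> (br y v p) 0
        + der y f p * \<Phi> (br x v p) 0 + der x (der y f) p"
    if x: "x \<in> sections M E" and y: "y \<in> sections M E" for x y
  proof -
    have yv: "br y v \<in> sections M E" and D: "der y f \<in> Cinf M"
      by (rule bracket_section[OF y v], rule der_smooth[OF y f])
    have "br x (br y (fmult M E f v))
        = sadd M E (br x (fmult M E f (br y v))) (br x (fmult M E (der y f) v))"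
      unfolding leibniz_rule[OF y v f]
      by (rule bracket_sadd[OF x fmult_section[OF f yv] fmult_section[OF D v]])
    then have "\<Phi> (br x (br y (fmult M E f v)) p) 0
        = \<Phi> (br x (fmult M E f (br y v)) p) 0 + \<Phi> (br x (fmult M E (der y f) v) p) 0"
      by (simp add: sadd_def p triv_fadd[OF U] section_in bracket_section x yv v fmult_section f D)
    then show ?thesis
      by (simp add: leibniz_coordinate[OF x yv f U] leibniz_coordinate[OF x v D U] v1)
  qed
  have coord_jacobi: "\<Phi> (br x (br y z) p) 0 = \<Phi> (br (br x y) z p) 0 + \<Phi> (br y (br x z) p) 0"
    if "z \<in> sections M E" for z
    unfolding jacobi[OF x y that]
    by (simp add: sadd_def p triv_fadd[OF U] section_in bracket_section x y that)
  have "\<Phi> (br (br x y) (fmult M E f v) p) 0 = f p * \<Phi> (br (br x y) v p) 0 + der (br x y) f p"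
    by (simp add: leibniz_coordinate[OF bracket_section[OF x y] v f U] v1)
  then show ?thesis
    using coord_jacobi[OF v] coord_jacobi[OF fmult_section[OF f v]] twice[OF x y] twice[OF y x]
    by (simp add: algebra_simps)
qed

text \<open>A tangent vector is determined by its values on global functions, since every germ of a smooth
function has a global representative.\<close>

lemma anchor_bracket:
  assumes x: "x \<in> sections M E" and y: "y \<in> sections M E"
  shows "on_sections M \<rho> (br x y) = lie_bracket M (on_sections M \<rho> x) (on_sections M \<rho> y)"
proof (rule extensionalityI)
  fix p assume p: "p \<in> points M"
  have D: "derivation_at M p (snd (\<rho> (z p)))" if "z \<in> sections M E" for z
    by (rule anchor_derivation[OF p section_in[OF that p]])
  note xy = bracket_section[OF x y]
  have "snd (\<rho> (br x y p)) f = (if smooth_near M p f then der x (der y f) p - der y (der x f) p else 0)" for f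
  proof (cases "smooth_near M p f")
    case False
    then show ?thesis using D[OF xy] by (simp add: derivation_at_def)
  next
    case True
    then obtain F N where F: "F \<in> Cinf M" and N: "openin (mtop M) N" "p \<in> N" "\<And>q. q \<in> N \<Longrightarrow> F q = f q"
      using smooth_germ_extends[OF manifold] by metis
    \<comment> \<open>Equality on all of \<open>N\<close>, and not only at \<open>p\<close>, is needed to differentiate once more.\<close>
    have Ff: "der z F q = der z f q" if z: "z \<in> sections M E" and q: "q \<in> N" for z q
    proof -
      have qM: "q \<in> points M" using openin_subset[OF N(1)] q by blast
      have "smooth_near M q F" by (rule Cinf_smooth_near[OF F qM])
      moreover from this have "smooth_near M q f" by (rule smooth_near_cong[OF manifold _ N(1) q N(3)])
      ultimately show ?thesis unfolding der_eq[OF qM]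
        by (rule derivation_at_cong[OF anchor_derivation[OF qM section_in[OF z qM]] _ _ N(1) q N(3)])
    qed
    have FF: "der z (der w F) p = der z (der w f) p" if z: "z \<in> sections M E" and w: "w \<in> sections M E" for z w
    proof -
      have "smooth_near M p (der w F)" by (rule Cinf_smooth_near[OF der_smooth[OF w F] p])
      moreover from this have "smooth_near M p (der w f)"
        by (rule smooth_near_cong[OF manifold _ N(1,2) Ff[OF w]])
      ultimately show ?thesis unfolding der_eq[OF p]
        by (rule derivation_at_cong[OF D[OF z] _ _ N(1,2) Ff[OF w]])
    qed
    have "snd (\<rho> (br x y p)) f = der (br x y) F p"
      using Ff[OF xy N(2)] by (simp add: der_eq[OF p])
    also have "\<dots> = der x (der y F) p - der y (der x F) p" by (rule der_bracket[OF x y F p])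
    finally show ?thesis using True FF x y by simp
  qed
  then show "on_sections M \<rho> (br x y) p = lie_bracket M (on_sections M \<rho> x) (on_sections M \<rho> y) p"
    using fst_anchor[OF p section_in[OF xy p]] p
    by (simp add: prod_eq_iff on_sections_def[of M \<rho> "br x y"] lie_bracket_def fun_eq_iff)
qed (simp_all add: on_sections_def lie_bracket_def)

text \<open>The coordinates of \<open>\<rho>(x)\<close> in a chart are linear in \<open>x\<close>, with the matrix entries of the
anchor as coefficients.\<close>

lemma anchor_section:
  assumes x: "x \<in> sections M E"
  shows "on_sections M \<rho> x \<in> sections M (tangent_bundle M)"
proof -
  have "smooth_fun_on M V (\<lambda>p. snd (on_sections M \<rho> x p) (\<lambda>q. \<psi> q i))"
    if V: "(V, \<psi>) \<in> atlas M" and i: "i < mdim M" for V \<psi> i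
  proof (rule smooth_fun_on_local[OF manifold])
    fix p assume p: "p \<in> V"
    note oV = chart_openin(1)[OF manifold V]
    then obtain U \<Phi> where U: "(U, \<Phi>) \<in> trivs E" "p \<in> U" using triv_at openin_subset p by blast
    have o: "openin (mtop M) (U \<inter> V)" using oV triv_openin[OF U(1)] by blast
    have M: "q \<in> points M" if "q \<in> U" for q using triv_in_points[OF U(1) that] .
    have "smooth_fun_on M (U \<inter> V) (\<lambda>q. snd (\<rho> (x q)) (\<lambda>q. \<psi> q i))"
    proof (rule smooth_fibre_linear[OF U(1) o])
      fix j assume j: "j < bundle_rank E"
      have "(V, \<lambda>v i. if i < mdim M then snd v (\<lambda>q. \<psi> q i) else 0) \<in> trivs (tangent_bundle M)"
        unfolding trivs_tangent_bundle using V by force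
      moreover have "\<forall>(U, \<Phi>)\<in>trivs E. \<forall>(V, \<Psi>)\<in>trivs (tangent_bundle M). \<forall>i<mdim M. \<forall>j<bundle_rank E.
          smooth_fun_on M (U \<inter> V) (\<lambda>p. \<Psi> (\<rho> (frame E \<Phi> j p)) i)"
        using anchor_morphism by (simp add: vbundle_morphism_def bundle_rank_tangent_bundle)
      ultimately have "smooth_fun_on M (U \<inter> V)
          (\<lambda>p. (\<lambda>v i. if i < mdim M then snd v (\<lambda>q. \<psi> q i) else 0) (\<rho> (frame E \<Phi> j p)) i)"
        using U(1) i j by fast
      then show "smooth_fun_on M (U \<inter> V) (\<lambda>p. snd (\<rho> (frame E \<Phi> j p)) (\<lambda>q. \<psi> q i))"
        using i by simp
      show "smooth_fun_on M (U \<inter> V) (\<lambda>p. \<Phi> (x p) j)"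
        by (rule smooth_fun_on_subset[OF section_smooth[OF x U(1)]]) simp
    qed (simp_all add: fibre_linear_anchor M section_in x)
    then have "smooth_fun_on M (U \<inter> V) (\<lambda>q. snd (on_sections M \<rho> x q) (\<lambda>q. \<psi> q i))"
      by (rule smooth_fun_on_cong[OF manifold o, rotated]) (simp add: on_sections_def M)
    then show "\<exists>N. openin (mtop M) N \<and> p \<in> N \<and> N \<subseteq> V \<and>
        smooth_fun_on M N (\<lambda>q. snd (on_sections M \<rho> x q) (\<lambda>q. \<psi> q i))"
      using o U(2) p by blast
  qed
  moreover have "on_sections M \<rho> x \<in> extensional (points M)" by (simp add: on_sections_def)
  moreover have "on_sections M \<rho> x p \<in> fibre (tangent_bundle M) p" if "p \<in> points M" for p
    using that by (simp add: on_sections_def anchor_in section_in x)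
  ultimately show ?thesis
    unfolding sections_def trivs_tangent_bundle bundle_rank_tangent_bundle by auto
qed

theorem anchor_loday_morphism:
  "loday_morphism M E br (tangent_bundle M) (lie_bracket M) (on_sections M \<rho>)"
  unfolding loday_morphism_def
proof (intro conjI ballI allI)
  fix x assume x: "x \<in> sections M E"
  show "on_sections M \<rho> x \<in> sections M (tangent_bundle M)" by (rule anchor_section[OF x])
  show "on_sections M \<rho> (fmult M E (\<lambda>_. c) x) = fmult M (tangent_bundle M) (\<lambda>_. c) (on_sections M \<rho> x)" for c
    by (rule extensionalityI[where A = "points M"])
      (simp_all add: on_sections_def fmult_def anchor_fscale section_in x)
  fix y assume y: "y \<in> sections M E"
  show "on_sections M \<rho> (sadd M E x y) = sadd M (tangent_bundle M) (on_sections M \<rho> x) (on_sections M \<rho> y)"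
    by (rule extensionalityI[where A = "points M"])
      (simp_all add: on_sections_def sadd_def anchor_fadd section_in x y)
  show "on_sections M \<rho> (br x y) = lie_bracket M (on_sections M \<rho> x) (on_sections M \<rho> y)"
    by (rule anchor_bracket[OF x y])
qed

end

theorem theorem2p1:
  fixes M :: "'m manifold"
    and E :: "('m, 'e) vbundle"
    and br :: "('m \<Rightarrow> 'e) \<Rightarrow> ('m \<Rightarrow> 'e) \<Rightarrow> 'm \<Rightarrow> 'e"
    and \<rho> :: "'e \<Rightarrow> 'm \<times> (('m \<Rightarrow> real) \<Rightarrow> real)"
    and B :: "'e \<Rightarrow> 'e \<Rightarrow> real"
  assumes "courant_algebroid M E br \<rho> B"
  shows "(\<forall>x\<in>sections M E. \<forall>y\<in>sections M E. \<forall>f\<in>Cinf M.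
            br x (fmult M E f y)
              = sadd M E (fmult M E f (br x y))
                         (fmult M E (vf_apply (on_sections M \<rho> x) f) y))
       \<and> loday_morphism M E br (tangent_bundle M) (lie_bracket M) (on_sections M \<rho>)"
proof -
  interpret courant M E br \<rho> B by (rule courant.intro[OF assms])
  show ?thesis using leibniz_rule anchor_loday_morphism by blast
qed
end
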